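(* For every integer $d\ge 1$, $$\lim_{n\to\infty}\frac{\gamma^{\mathrm{IP}}(R^d_n)}{\gamma^{\mathrm{RW}}(R^d_n)}=1 .$$
   Context: For integers $d\ge1$, $n\ge 2$, let $R^d_n=\{(x_1,\dots,x_d)\in\mathbb{Z}^d : 1\le x_1,\dots,x_d\le n\}$, regarded as the induced subgraph of $\mathbb{Z}^d$ whose edges are the unordered pairs $\{x,y\}\subseteq R^d_n$ with $\|x-y\|_1=1$. For a finite simple graph $G$ with vertices enumerated as $x_1,\dots,x_N$, $N\ge2$ (the quantities below do not depend on the enumeration), and edge set $E$, let $X_N=\{1,\dots,N\}$ and let $S_N$ be the group of permutations of $X_N$. Let $\ell^2(X_N)$ and $\ell^2(S_N)$ be the spaces of complex-valued functions on $X_N$ and $S_N$ with the standard inner products $\langle f,g\rangle=\sum f\overline g$. Write $(i,j)\in S_N$ for the transposition of $i$ and $j$, and define the random walk and interchange process generators by $$(\Omega^{\mathrm{RW}}(G)f)(m)=\sum_{\{x_i,x_j\}\in E}\big[f((i,j)(m))-f(m)\big],\quad f\in\ell^2(X_N),\ m\in X_N,$$ $$(\Omega^{\mathrm{IP}}(G)f)(\pi)=\sum_{\{x_i,x_j\}\in E}\big[f((i,j)\pi)-f(\pi)\big],\quad f\in\ell^2(S_N),\ \pi\in S_N,$$ where $(i,j)\pi$ is the product (composition) in $S_N$. For $\Omega=\Omega^{\mathrm{RW}}(G)$ (respectively $\Omega^{\mathrm{IP}}(G)$), the spectral gap $\gamma^{\mathrm{RW}}(G)$ (respectively $\gamma^{\mathrm{IP}}(G)$)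 is $$\min\{\langle f,-\Omega f\rangle : \|f\|=1,\ \langle f,1\rangle=0\},$$ the minimum being over $f$ in $\ell^2(X_N)$ (respectively $\ell^2(S_N)$), where $1$ is the constant function. *)

theory Defs
  imports Complex_Main "HOL-Combinatorics.Permutations" "HOL-Library.FuncSet"
begin

text \<open>
  A point of \<open>\<int>\<^sup>d\<close> is a function on the coordinate set \<open>{1..d}\<close>, extensional outside it,
  so that distinct functions are distinct points and the grid is finite.
\<close>

definition grid :: "nat \<Rightarrow> nat \<Rightarrow> (nat \<Rightarrow> int) set" where
  "grid d n = {1..d} \<rightarrow>\<^sub>E {1..int n}"

definition grid_edges :: "nat \<Rightarrow> nat \<Rightarrow> (nat \<Rightarrow> int) set set" where
  "grid_edges d n =
     {{x, y} | x y. x \<in> grid d n \<and> y \<in> grid d n \<and> (\<Sum>k=1..d. \<bar>x k - y k\<bar>) = 1}"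

text \<open>
  A finite simple graph is given by its vertex set \<open>V\<close> and its set \<open>E\<close> of two-element edges;
  an enumeration of its vertices is a bijection \<open>x\<close> from \<open>{1..card V}\<close> to \<open>V\<close>.
\<close>

definition enumerates :: "(nat \<Rightarrow> 'a) \<Rightarrow> 'a set \<Rightarrow> bool" where
  "enumerates x V \<longleftrightarrow> bij_betw x {1..card V} V"

text \<open>Each edge is represented by exactly one pair of indices, the one with \<open>i < j\<close>.\<close>

definition edge_pairs :: "'a set \<Rightarrow> 'a set set \<Rightarrow> (nat \<Rightarrow> 'a) \<Rightarrow> (nat \<times> nat) set" where
  "edge_pairs V E x =
     {(i, j). i \<in> {1..card V} \<and> j \<in> {1..card V} \<and> i < j \<and> {x i, x j} \<in> E}"

definition RW_gen ::
  "'a set \<Rightarrow> 'a set set \<Rightarrow> (nat \<Rightarrow> 'a) \<Rightarrow> (nat \<Rightarrow> complex) \<Rightarrow> nat \<Rightarrow> complex" where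
  "RW_gen V E x f m = (\<Sum>(i, j)\<in>edge_pairs V E x. f (transpose i j m) - f m)"

definition IP_gen ::
  "'a set \<Rightarrow> 'a set set \<Rightarrow> (nat \<Rightarrow> 'a) \<Rightarrow> ((nat \<Rightarrow> nat) \<Rightarrow> complex) \<Rightarrow> (nat \<Rightarrow> nat) \<Rightarrow> complex" where
  "IP_gen V E x f \<pi> = (\<Sum>(i, j)\<in>edge_pairs V E x. f (transpose i j \<circ> \<pi>) - f \<pi>)"

text \<open>
  Elements of \<open>\<ell>\<^sup>2(A)\<close>, for finite \<open>A\<close>, are represented by total functions of which only the
  values on \<open>A\<close> matter.
\<close>

definition l2_inner :: "'b set \<Rightarrow> ('b \<Rightarrow> complex) \<Rightarrow> ('b \<Rightarrow> complex) \<Rightarrow> complex" where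
  "l2_inner A f g = (\<Sum>a\<in>A. f a * cnj (g a))"

definition l2_norm :: "'b set \<Rightarrow> ('b \<Rightarrow> complex) \<Rightarrow> real" where
  "l2_norm A f = sqrt (Re (l2_inner A f f))"

text \<open>
  The generators are self-adjoint, so the quadratic form is real and \<open>Re\<close> only changes its type.
  \<open>LEAST\<close> denotes the minimum; it is attained because \<open>A\<close> is finite with at least two elements.
\<close>

definition spectral_gap ::
  "'b set \<Rightarrow> (('b \<Rightarrow> complex) \<Rightarrow> 'b \<Rightarrow> complex) \<Rightarrow> real" where
  "spectral_gap A \<Omega> =
     (LEAST c. c \<in> {Re (l2_inner A f (\<lambda>a. - \<Omega> f a)) | f.
                      l2_norm A f = 1 \<and> l2_inner A f (\<lambda>_. 1) = 0})"

definition RW_gap :: "'a set \<Rightarrow> 'a set set \<Rightarrow> (nat \<Rightarrow> 'a) \<Rightarrow> real" where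
  "RW_gap V E x = spectral_gap {1..card V} (RW_gen V E x)"

definition IP_gap :: "'a set \<Rightarrow> 'a set set \<Rightarrow> (nat \<Rightarrow> 'a) \<Rightarrow> real" where
  "IP_gap V E x = spectral_gap {\<pi>. \<pi> permutes {1..card V}} (IP_gen V E x)"

end

theory Submission
  imports Defs "HOL-Analysis.Function_Topology"
begin

text \<open>
  Aldous' spectral gap conjecture, proved by Caputo, Liggett and Richthammer, says that the two gaps
  agree for every weighted graph; for a connected graph they are positive, and their quotient is
  \<open>1\<close>. The proof is by induction on the number of vertices. Projecting an eigenfunction of the
  interchange process to the position of one particle gives an eigenfunction of the random walk,
  unless all these projections vanish. In that case a vertex \<open>x\<close> is eliminated by electrical network
  reduction. This does not decrease the gap of the random walk, and by the octopus inequality it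
  does not increase the Dirichlet form of the interchange process; conditioned on the particle at
  \<open>x\<close>, the eigenfunction has mean zero on the smaller vertex set, where the induction hypothesis
  applies.

  The octopus inequality says that a self-adjoint element \<open>w\<close> of the group algebra, quadratic in
  the conductances \<open>c\<close> at \<open>x\<close>, is positive. It suffices that \<open>2 u w - w\<^sup>2\<close> is positive for some
  scalar \<open>u > 0\<close>. With \<open>u = (\<Sum>j. c j)\<^sup>2 + (\<Sum>j. (c j)\<^sup>2)\<close> this element is quartic in \<open>c\<close>,
  and after symmetrization the coefficient \<open>g\<close> of each monomial involves at most five vertices and
  satisfies \<open>g\<^sup>2 = 24 g\<close>.
\<close>

section \<open>Certificates in the group algebra of five letters\<close>

fun add_term :: "'a \<times> int \<Rightarrow> ('a \<times> int) list \<Rightarrow> ('a \<times> int) list" where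
  "add_term t [] = [t]"
| "add_term t (u # us) =
     (if fst t = fst u then (fst u, snd t + snd u) # us else u # add_term t us)"

definition collect_terms :: "('a \<times> int) list \<Rightarrow> ('a \<times> int) list" where
  "collect_terms L = filter (\<lambda>t. snd t \<noteq> 0) (foldr add_term L [])"

definition lin_eval :: "('a \<Rightarrow> real) \<Rightarrow> ('a \<times> int) list \<Rightarrow> real" where
  "lin_eval b L = (\<Sum>(s, z)\<leftarrow>L. of_int z * b s)"

definition scale_terms :: "int \<Rightarrow> ('a \<times> int) list \<Rightarrow> ('a \<times> int) list" where
  "scale_terms k L = map (\<lambda>(s, z). (s, k * z)) L"

lemma lin_eval_simps [simp]:
  "lin_eval b [] = 0"
  "lin_eval b (t # L) = of_int (snd t) * b (fst t) + lin_eval b L"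
  "lin_eval b (L @ M) = lin_eval b L + lin_eval b M"
  by (simp_all add: lin_eval_def case_prod_unfold)

lemma lin_eval_scale [simp]: "lin_eval b (scale_terms k L) = of_int k * lin_eval b L"
  by (induction L) (auto simp: scale_terms_def algebra_simps)

lemma lin_eval_add_term: "lin_eval b (add_term t L) = of_int (snd t) * b (fst t) + lin_eval b L"
  by (induction t L rule: add_term.induct) (auto simp: algebra_simps)

text \<open>Makes a list computation a proof: if the collected list is \<open>[]\<close>, the
  original element evaluates to zero under every \<open>b\<close>.\<close>

lemma lin_eval_collect [simp]: "lin_eval b (collect_terms L) = lin_eval b L"
proof -
  have "lin_eval b (filter (\<lambda>t. snd t \<noteq> 0) M) = lin_eval b M" for M
    by (induction M) auto
  moreover have "lin_eval b (foldr add_term L []) = lin_eval b L"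
    by (induction L) (auto simp: lin_eval_add_term)
  ultimately show ?thesis by (simp add: collect_terms_def)
qed

text \<open>A permutation of \<open>{..<r}\<close> is encoded by the list of its values.\<close>

definition lperm :: "nat \<Rightarrow> nat list \<Rightarrow> bool" where
  "lperm r s \<longleftrightarrow> length s = r \<and> distinct s \<and> (\<forall>v\<in>set s. v < r)"

definition ltrans :: "nat \<Rightarrow> nat \<Rightarrow> nat \<Rightarrow> nat list" where
  "ltrans r i j = map (\<lambda>v. if v = i then j else if v = j then i else v) [0..<r]"

definition lcomp :: "nat list \<Rightarrow> nat list \<Rightarrow> nat list" where
  "lcomp s t = map (\<lambda>v. s ! v) t"

definition linv :: "nat list \<Rightarrow> nat list" where
  "linv s = map (\<lambda>v. length (takeWhile (\<lambda>u. u \<noteq> v) s)) [0..<length s]"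

text \<open>An element of the group algebra is a list of permutations with integer coefficients.\<close>

type_synonym perm_alg = "(nat list \<times> int) list"

text \<open>Formal counterpart of the inner product of \<open>X f\<close> and \<open>Y f\<close>, that is, the product \<open>Y X\<^sup>*\<close>.\<close>

definition alg_pair :: "perm_alg \<Rightarrow> perm_alg \<Rightarrow> perm_alg" where
  "alg_pair X Y = concat (map (\<lambda>(s, z). let s' = linv s in map (\<lambda>(t, y). (lcomp t s', z * y)) Y) X)"

text \<open>The letter \<open>0\<close> stands for the centre of the star; see \<open>star_op\<close> and \<open>star_form\<close> below.\<close>

definition star_alg :: "nat \<Rightarrow> nat \<Rightarrow> nat \<Rightarrow> perm_alg" where
  "star_alg r j k = [([0..<r], 1), (ltrans r j k, 1), (ltrans r 0 j, -1), (ltrans r 0 k, -1)]"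

text \<open>Formal version of \<open>star_form\<close>. The scalar is the coefficient belonging to
  \<open>c j * c k\<close> in \<open>2 u\<close>: the squared sum gives 2 for each ordered pair, the
  sum of squares 2 more on the diagonal.\<close>

definition form_alg :: "nat \<Rightarrow> nat \<Rightarrow> nat \<Rightarrow> nat \<Rightarrow> nat \<Rightarrow> perm_alg" where
  "form_alg r j k l m = scale_terms (if j = k then 4 else 2) (star_alg r l m) @
     scale_terms (-1) (alg_pair (star_alg r j k) (star_alg r l m))"

text \<open>The six terms are the three splittings of the four indices into two pairs, each in both
  orders. As \<open>star_op\<close> is symmetric in \<open>j\<close> and \<open>k\<close>, they make
  the coefficient as symmetric as the monomial.\<close>

definition sym_form_alg :: "nat \<Rightarrow> nat \<Rightarrow> nat \<Rightarrow> nat \<Rightarrow> nat \<Rightarrow> perm_alg" where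
  "sym_form_alg r j k l m = collect_terms (form_alg r j k l m @ form_alg r l m j k @ form_alg r j l k m
     @ form_alg r k m j l @ form_alg r j m k l @ form_alg r k l j m)"

text \<open>
  \<open>g g\<^sup>* = 24 g\<close>: the element \<open>g\<close> is \<open>24\<close> times an orthogonal projection, hence positive.
\<close>

definition certified :: "nat \<times> nat \<times> nat \<times> nat \<times> nat \<Rightarrow> bool" where
  "certified = (\<lambda>(r, j, k, l, m). let g = sym_form_alg r j k l m in
     list_all (\<lambda>t. lperm r (fst t)) g \<and>
     collect_terms (scale_terms 24 g @ scale_terms (-1) (alg_pair g g)) = [])"

text \<open>
  The entries \<open>(r, j, k, l, m)\<close> run through the set partitions of four positions, the blocks being
  numbered from \<open>1\<close> in order of appearance; \<open>r\<close> counts the blocks together with the letter \<open>0\<close>.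
\<close>

definition coincidence_patterns :: "(nat \<times> nat \<times> nat \<times> nat \<times> nat) list" where
  "coincidence_patterns =
     [(2,1,1,1,1), (3,1,1,1,2), (3,1,1,2,1), (3,1,2,1,1), (3,1,2,2,2),
      (3,1,1,2,2), (3,1,2,1,2), (3,1,2,2,1),
      (4,1,1,2,3), (4,1,2,1,3), (4,1,2,3,1), (4,1,2,2,3), (4,1,2,3,2), (4,1,2,3,3),
      (5,1,2,3,4)]"

lemma certified_small: "list_all certified (butlast coincidence_patterns)"
  by code_simp

text \<open>Four distinct leaves: the only pattern computed with permutations of all five
  letters.\<close>

lemma certified_distinct: "certified (5,1,2,3,4)"
  by code_simp

section \<open>Action on functions of permutations\<close>

lemma lperm_nth: "lperm r s \<Longrightarrow> i < r \<Longrightarrow> s ! i < r"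
  by (auto simp: lperm_def)

lemma lperm_id: "lperm r [0..<r]"
  by (auto simp: lperm_def)

lemma lperm_ltrans: "i < r \<Longrightarrow> j < r \<Longrightarrow> lperm r (ltrans r i j)"
  by (auto simp: lperm_def ltrans_def distinct_map inj_on_def)

lemma length_linv [simp]: "length (linv s) = length s"
  by (simp add: linv_def)

lemma takeWhile_index:
  assumes "distinct s" "i < length s"
  shows "length (takeWhile (\<lambda>u. u \<noteq> s ! i) s) = i"
proof -
  have "takeWhile (\<lambda>u. u \<noteq> s ! i) s = take i s"
    using assms by (intro takeWhile_eq_take_P_nth) (auto simp: nth_eq_iff_index_eq)
  then show ?thesis using assms by simp
qed

lemma lcomp_linv: "lperm r s \<Longrightarrow> lcomp (linv s) s = [0..<r]"
  by (intro nth_equalityI) (auto simp: lcomp_def linv_def lperm_def takeWhile_index)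

lemma lperm_linv:
  assumes "lperm r s"
  shows "lperm r (linv s)"
proof -
  \<comment> \<open>The \<open>r\<close> distinct entries below \<open>r\<close> exhaust
    \<open>{..<r}\<close>, so every \<open>v\<close> has a position \<open>idx v\<close>.\<close>
  have "set s = {..<r}"
    using assms by (intro card_subset_eq) (auto simp: lperm_def distinct_card)
  then have "\<exists>i<r. s ! i = v" if "v < r" for v
    using that assms by (metis in_set_conv_nth lessThan_iff lperm_def)
  then obtain idx where idx: "idx v < r" "s ! idx v = v" if "v < r" for v
    by metis
  have "length (takeWhile (\<lambda>u. u \<noteq> v) s) = idx v" if "v < r" for v
    using takeWhile_index[of s "idx v"] idx[OF that] assms by (auto simp: lperm_def)
  then have "linv s = map idx [0..<r]"
    using assms by (auto simp: linv_def lperm_def)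
  moreover have "inj_on idx {0..<r}"
    by (rule inj_onI) (metis atLeastLessThan_iff idx(2))
  ultimately show ?thesis
    using idx by (auto simp: lperm_def distinct_map)
qed

text \<open>Letter \<open>i\<close> is read as the vertex \<open>ps ! i\<close>, so that one
  certificate serves every choice of distinct vertices, with the centre of the star at the head of
  \<open>ps\<close>.\<close>

definition embed :: "'a list \<Rightarrow> nat list \<Rightarrow> 'a \<Rightarrow> 'a" where
  "embed ps s v = (if v \<in> set ps then ps ! (s ! (THE i. i < length ps \<and> ps ! i = v)) else v)"

lemma embed_nth:
  assumes "distinct ps" "i < length ps"
  shows "embed ps s (ps ! i) = ps ! (s ! i)"
proof -
  have "(THE k. k < length ps \<and> ps ! k = ps ! i) = i"
    using assms by (auto simp: nth_eq_iff_index_eq)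
  then show ?thesis using assms by (simp add: embed_def)
qed

lemma embed_outside: "v \<notin> set ps \<Longrightarrow> embed ps s v = v"
  by (simp add: embed_def)

lemma embed_permutes:
  assumes "distinct ps" "lperm (length ps) s"
  shows "embed ps s permutes set ps"
proof (rule bij_imp_permutes)
  have maps: "embed ps s ` set ps \<subseteq> set ps"
    using assms by (auto simp: in_set_conv_nth embed_nth) (metis lperm_nth)
  have "inj_on (embed ps s) (set ps)"
  proof (rule inj_onI)
    fix u v assume "u \<in> set ps" "v \<in> set ps" and eq: "embed ps s u = embed ps s v"
    then obtain i j where "i < length ps" "j < length ps" "u = ps ! i" "v = ps ! j"
      by (metis in_set_conv_nth)
    with eq assms show "u = v"
      by (auto simp: embed_nth nth_eq_iff_index_eq lperm_nth) (auto simp: lperm_def nth_eq_iff_index_eq)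
  qed
  with maps show "bij_betw (embed ps s) (set ps) (set ps)"
    by (simp add: bij_betw_def endo_inj_surj)
qed (simp add: embed_outside)

lemma embed_lcomp:
  assumes "distinct ps" "lperm (length ps) t"
  shows "embed ps (lcomp s t) = embed ps s \<circ> embed ps t"
proof
  fix v
  show "embed ps (lcomp s t) v = (embed ps s \<circ> embed ps t) v"
  proof (cases "v \<in> set ps")
    case True
    then obtain i where "i < length ps" "v = ps ! i" by (metis in_set_conv_nth)
    moreover have "length t = length ps" using assms by (simp add: lperm_def)
    ultimately show ?thesis using assms by (simp add: embed_nth lperm_nth lcomp_def)
  qed (simp add: embed_outside)
qed

lemma embed_id: "distinct ps \<Longrightarrow> embed ps [0..<length ps] = id"
proof
  fix v assume "distinct ps"
  then show "embed ps [0..<length ps] v = id v"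
    by (cases "v \<in> set ps") (auto simp: embed_outside in_set_conv_nth embed_nth)
qed

lemma embed_linv:
  assumes "distinct ps" "lperm (length ps) s"
  shows "embed ps (linv s) = inv (embed ps s)"
proof -
  have "embed ps (linv s) \<circ> embed ps s = id"
    using embed_lcomp[OF assms, of "linv s"] assms by (simp add: lcomp_linv embed_id)
  moreover have "embed ps s \<circ> inv (embed ps s) = id"
    using embed_permutes[OF assms] by (rule permutes_inv_o(1))
  ultimately show ?thesis by (metis comp_assoc comp_id id_comp)
qed

lemma embed_ltrans:
  assumes "distinct ps" "i < length ps" "j < length ps"
  shows "embed ps (ltrans (length ps) i j) = transpose (ps ! i) (ps ! j)"
proof
  fix v
  show "embed ps (ltrans (length ps) i j) v = transpose (ps ! i) (ps ! j) v"
  proof (cases "v \<in> set ps")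
    case True
    then obtain k where "k < length ps" "v = ps ! k" by (metis in_set_conv_nth)
    then show ?thesis using assms
      by (auto simp: embed_nth ltrans_def transpose_def nth_eq_iff_index_eq)
  next
    case False
    then show ?thesis using assms by (auto simp: embed_outside transpose_def)
  qed
qed

section \<open>Left translations and their correlations\<close>

definition perm_inner :: "'a set \<Rightarrow> (('a \<Rightarrow> 'a) \<Rightarrow> real) \<Rightarrow> (('a \<Rightarrow> 'a) \<Rightarrow> real) \<Rightarrow> real" where
  "perm_inner V f g = (\<Sum>\<pi> | \<pi> permutes V. f \<pi> * g \<pi>)"

text \<open>Matrix coefficient of left translation at \<open>f\<close>. A group algebra element is
  positive when its evaluation against this function is nonnegative for every
  \<open>f\<close>.\<close>

definition autocorr :: "'a set \<Rightarrow> (('a \<Rightarrow> 'a) \<Rightarrow> real) \<Rightarrow> ('a \<Rightarrow> 'a) \<Rightarrow> real" where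
  "autocorr V f \<sigma> = perm_inner V f (\<lambda>\<pi>. f (\<sigma> \<circ> \<pi>))"

text \<open>Left translation by \<open>\<sigma>\<close> is a bijection of the permutations of
  \<open>V\<close>, so only the quotient of the two translations matters.\<close>

lemma perm_inner_translates:
  assumes "\<sigma> permutes V" "\<tau> permutes V"
  shows "perm_inner V (\<lambda>\<pi>. f (\<sigma> \<circ> \<pi>)) (\<lambda>\<pi>. f (\<tau> \<circ> \<pi>)) = autocorr V f (\<tau> \<circ> inv \<sigma>)"
proof -
  have "autocorr V f (\<tau> \<circ> inv \<sigma>) = (\<Sum>\<pi> | \<pi> permutes V. f (\<sigma> \<circ> \<pi>) * f (\<tau> \<circ> inv \<sigma> \<circ> (\<sigma> \<circ> \<pi>)))"
    unfolding autocorr_def perm_inner_def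
    by (rule setum_permutations_compose_left[OF assms(1)])
  moreover have "\<tau> \<circ> inv \<sigma> \<circ> (\<sigma> \<circ> \<pi>) = \<tau> \<circ> \<pi>" for \<pi> :: "'a \<Rightarrow> 'a"
    using permutes_inv_o(2)[OF assms(1)] by (metis comp_assoc comp_id)
  ultimately show ?thesis by (simp only: perm_inner_def)
qed

definition alg_act :: "'a list \<Rightarrow> (('a \<Rightarrow> 'a) \<Rightarrow> real) \<Rightarrow> perm_alg \<Rightarrow> ('a \<Rightarrow> 'a) \<Rightarrow> real" where
  "alg_act ps f X \<pi> = lin_eval (\<lambda>s. f (embed ps s \<circ> \<pi>)) X"

lemma perm_inner_add_left:
  "perm_inner V (\<lambda>\<pi>. c * f \<pi> + g \<pi>) h = c * perm_inner V f h + perm_inner V g h"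
  by (simp add: perm_inner_def algebra_simps sum.distrib sum_distrib_left)

lemma perm_inner_commute: "perm_inner V f g = perm_inner V g f"
  by (simp add: perm_inner_def mult.commute)

lemma perm_inner_self_nonneg: "perm_inner V f f \<ge> 0"
  by (simp add: perm_inner_def sum_nonneg)

lemma perm_inner_alg_act_right:
  "perm_inner V h (alg_act ps f Y)
     = lin_eval (\<lambda>t. perm_inner V h (\<lambda>\<pi>. f (embed ps t \<circ> \<pi>))) Y"
proof (induction Y)
  case (Cons t Y)
  have "alg_act ps f (t # Y) = (\<lambda>\<pi>. of_int (snd t) * f (embed ps (fst t) \<circ> \<pi>) + alg_act ps f Y \<pi>)"
    by (auto simp: alg_act_def)
  then have "perm_inner V h (alg_act ps f (t # Y))
      = of_int (snd t) * perm_inner V (\<lambda>\<pi>. f (embed ps (fst t) \<circ> \<pi>)) h + perm_inner V (alg_act ps f Y) h"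
    by (simp only: perm_inner_commute[of V h] perm_inner_add_left)
  with Cons show ?case by (simp only: lin_eval_simps perm_inner_commute)
qed (simp add: perm_inner_def alg_act_def)

text \<open>Bilinearity reduces this to two single translates, where
  \<open>perm_inner_translates\<close> yields the product that \<open>alg_pair\<close> forms. In
  particular, the formal pairing of an element with itself evaluates to a squared norm.\<close>

lemma perm_inner_alg_act:
  assumes ps: "distinct ps" "set ps \<subseteq> V"
    and X: "list_all (\<lambda>t. lperm (length ps) (fst t)) X"
    and Y: "list_all (\<lambda>t. lperm (length ps) (fst t)) Y"
  shows "perm_inner V (alg_act ps f X) (alg_act ps f Y)
    = lin_eval (\<lambda>s. autocorr V f (embed ps s)) (alg_pair X Y)"
  using X
proof (induction X)
  case Nil
  show ?case by (simp add: perm_inner_def alg_act_def alg_pair_def)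
next
  case (Cons u X)
  obtain s z where u: "u = (s, z)" by (cases u)
  have s: "lperm (length ps) s" using Cons.prems by (simp add: u)
  have perm: "embed ps t permutes V" if "lperm (length ps) t" for t
    using embed_permutes[OF ps(1) that] ps(2) by (rule permutes_subset)
  have linv: "lperm (length ps) (linv s)"
    by (rule lperm_linv[OF s])
  have single: "perm_inner V (\<lambda>\<pi>. f (embed ps s \<circ> \<pi>)) (alg_act ps f Y)
      = lin_eval (\<lambda>s. autocorr V f (embed ps s)) (map (\<lambda>(t, y). (lcomp t (linv s), y)) Y)"
    unfolding perm_inner_alg_act_right using Y
  proof (induction Y)
    case (Cons v Y)
    obtain t y where v: "v = (t, y)" by (cases v)
    have t: "lperm (length ps) t" using Cons.prems by (simp add: v)
    have "list_all (\<lambda>t. lperm (length ps) (fst t)) Y" using Cons.prems by simp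
    note IH = Cons.IH[OF this]
    show ?case
      by (simp only: v list.map lin_eval_simps fst_conv snd_conv prod.case IH embed_lcomp[OF ps(1) linv]
          perm_inner_translates[OF perm[OF s] perm[OF t]] embed_linv[OF ps(1) s])
  qed simp
  have pair: "lin_eval b (alg_pair (u # X) Y)
      = of_int z * lin_eval b (map (\<lambda>(t, y). (lcomp t (linv s), y)) Y) + lin_eval b (alg_pair X Y)" for b
  proof -
    have "map (\<lambda>(t, y). (lcomp t (linv s), z * y)) Y = scale_terms z (map (\<lambda>(t, y). (lcomp t (linv s), y)) Y)"
      by (auto simp: scale_terms_def)
    then show ?thesis by (simp add: alg_pair_def u Let_def)
  qed
  have "alg_act ps f (u # X) = (\<lambda>\<pi>. of_int z * f (embed ps s \<circ> \<pi>) + alg_act ps f X \<pi>)"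
    by (auto simp: alg_act_def u)
  then show ?case using Cons by (simp add: perm_inner_add_left single pair)
qed

section \<open>The octopus inequality\<close>

text \<open>
  Since \<open>transpose j j = id\<close>, the quadratic form of \<open>\<Sum>j k. c j * c k * star_op x f j k\<close> is the
  difference of the two sides of the octopus inequality, without any case distinction on \<open>j = k\<close>.
\<close>

definition star_op :: "'a \<Rightarrow> (('a \<Rightarrow> 'a) \<Rightarrow> real) \<Rightarrow> 'a \<Rightarrow> 'a \<Rightarrow> ('a \<Rightarrow> 'a) \<Rightarrow> real" where
  "star_op x f j k \<pi> =
     f \<pi> + f (transpose j k \<circ> \<pi>) - f (transpose x j \<circ> \<pi>) - f (transpose x k \<circ> \<pi>)"

text \<open>
  Summed against \<open>c j * c k * c l * c m\<close>, this gives \<open>2 u \<langle>f, w f\<rangle> - \<parallel>w f\<parallel>\<^sup>2\<close> with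
  \<open>w f = star_sum Y c x f\<close> and \<open>u = (\<Sum>j. c j)\<^sup>2 + (\<Sum>j. (c j)\<^sup>2)\<close>.
\<close>

definition star_form :: "'a set \<Rightarrow> 'a \<Rightarrow> (('a \<Rightarrow> 'a) \<Rightarrow> real) \<Rightarrow> 'a \<Rightarrow> 'a \<Rightarrow> 'a \<Rightarrow> 'a \<Rightarrow> real" where
  "star_form V x f j k l m = (if j = k then 4 else 2) * perm_inner V f (star_op x f l m)
     - perm_inner V (star_op x f j k) (star_op x f l m)"

lemma star_alg_lperm:
  "j < r \<Longrightarrow> k < r \<Longrightarrow> list_all (\<lambda>t. lperm r (fst t)) (star_alg r j k)"
  by (auto simp: star_alg_def intro!: lperm_id lperm_ltrans)

lemma alg_act_star_alg:
  assumes "distinct ps" "j < length ps" "k < length ps"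
  shows "alg_act ps f (star_alg (length ps) j k) = star_op (ps ! 0) f (ps ! j) (ps ! k)"
proof -
  have "0 < length ps" using assms by auto
  then show ?thesis using assms
    by (intro ext) (simp add: alg_act_def star_alg_def embed_id embed_ltrans star_op_def)
qed

lemma lin_eval_form_alg:
  assumes "distinct ps" "set ps \<subseteq> V"
    and "j < length ps" "k < length ps" "l < length ps" "m < length ps"
  shows "lin_eval (\<lambda>s. autocorr V f (embed ps s)) (form_alg (length ps) j k l m)
    = star_form V (ps ! 0) f (ps ! j) (ps ! k) (ps ! l) (ps ! m)"
proof -
  let ?b = "\<lambda>s. autocorr V f (embed ps s)"
  have "lin_eval ?b (star_alg (length ps) l m) = perm_inner V f (star_op (ps ! 0) f (ps ! l) (ps ! m))"
    unfolding alg_act_star_alg[OF assms(1,5,6), symmetric] perm_inner_alg_act_right autocorr_def ..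
  moreover have "lin_eval ?b (alg_pair (star_alg (length ps) j k) (star_alg (length ps) l m))
      = perm_inner V (star_op (ps ! 0) f (ps ! j) (ps ! k)) (star_op (ps ! 0) f (ps ! l) (ps ! m))"
    by (simp only: perm_inner_alg_act[OF assms(1,2) star_alg_lperm star_alg_lperm, symmetric] assms alg_act_star_alg)
  moreover have "j = k \<longleftrightarrow> ps ! j = ps ! k"
    using assms by (simp add: nth_eq_iff_index_eq)
  ultimately show ?thesis by (simp add: form_alg_def star_form_def)
qed

definition sym_star_form :: "'a set \<Rightarrow> 'a \<Rightarrow> (('a \<Rightarrow> 'a) \<Rightarrow> real) \<Rightarrow> 'a \<Rightarrow> 'a \<Rightarrow> 'a \<Rightarrow> 'a \<Rightarrow> real" where
  "sym_star_form V x f j k l m =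
     star_form V x f j k l m + star_form V x f l m j k + star_form V x f j l k m
     + star_form V x f k m j l + star_form V x f j m k l + star_form V x f k l j m"

text \<open>By the certificate, 24 times the form of \<open>g\<close> is the squared norm of
  \<open>g\<close> applied to \<open>f\<close>.\<close>

lemma sym_star_form_nonneg_pattern:
  assumes "distinct ps" "set ps \<subseteq> V" "certified (length ps, j, k, l, m)"
    and "j < length ps" "k < length ps" "l < length ps" "m < length ps"
  shows "sym_star_form V (ps ! 0) f (ps ! j) (ps ! k) (ps ! l) (ps ! m) \<ge> 0"
proof -
  let ?b = "\<lambda>s. autocorr V f (embed ps s)"
  define g where "g = sym_form_alg (length ps) j k l m"
  have g: "list_all (\<lambda>t. lperm (length ps) (fst t)) g"
    and zero: "collect_terms (scale_terms 24 g @ scale_terms (-1) (alg_pair g g)) = []"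
    using assms(3) by (auto simp: certified_def g_def Let_def)
  have "lin_eval ?b (collect_terms (scale_terms 24 g @ scale_terms (-1) (alg_pair g g))) = 0"
    unfolding zero by simp
  then have "24 * lin_eval ?b g = lin_eval ?b (alg_pair g g)"
    by simp
  also have "\<dots> = perm_inner V (alg_act ps f g) (alg_act ps f g)"
    by (rule perm_inner_alg_act[OF assms(1,2) g g, symmetric])
  finally have "lin_eval ?b g \<ge> 0"
    using perm_inner_self_nonneg[of V "alg_act ps f g"] by linarith
  moreover have "lin_eval ?b g = sym_star_form V (ps ! 0) f (ps ! j) (ps ! k) (ps ! l) (ps ! m)"
    unfolding g_def sym_form_alg_def lin_eval_collect lin_eval_simps sym_star_form_def
    by (simp add: lin_eval_form_alg assms)
  ultimately show ?thesis by simp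
qed

lemma certified: "p \<in> set coincidence_patterns \<Longrightarrow> certified p"
  using certified_small certified_distinct by (auto simp: coincidence_patterns_def)

text \<open>The 15 cases are the set partitions of the positions of \<open>j\<close>,
  \<open>k\<close>, \<open>l\<close>, \<open>m\<close>. In each, \<open>ps\<close> lists
  \<open>x\<close> and then the distinct leaves in order of appearance, matching the numbering in
  \<open>coincidence_patterns\<close>.\<close>

lemma sym_star_form_nonneg:
  assumes "x \<in> V" "j \<in> V - {x}" "k \<in> V - {x}" "l \<in> V - {x}" "m \<in> V - {x}"
  shows "sym_star_form V x f j k l m \<ge> 0"
proof -
  note pat = sym_star_form_nonneg_pattern[where f = f and V = V]
  consider
    (1) "k = j" "l = j" "m = j"
  | (2) "k = j" "l = j" "m \<noteq> j"
  | (3) "k = j" "l \<noteq> j" "m = j"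
  | (4) "k = j" "l \<noteq> j" "m = l"
  | (5) "k = j" "l \<noteq> j" "m \<noteq> j" "m \<noteq> l"
  | (6) "k \<noteq> j" "l = j" "m = j"
  | (7) "k \<noteq> j" "l = j" "m = k"
  | (8) "k \<noteq> j" "l = j" "m \<noteq> j" "m \<noteq> k"
  | (9) "k \<noteq> j" "l = k" "m = j"
  | (10) "k \<noteq> j" "l = k" "m = k"
  | (11) "k \<noteq> j" "l = k" "m \<noteq> j" "m \<noteq> k"
  | (12) "k \<noteq> j" "l \<noteq> j" "l \<noteq> k" "m = j"
  | (13) "k \<noteq> j" "l \<noteq> j" "l \<noteq> k" "m = k"
  | (14) "k \<noteq> j" "l \<noteq> j" "l \<noteq> k" "m = l"
  | (15) "k \<noteq> j" "l \<noteq> j" "l \<noteq> k" "m \<noteq> j" "m \<noteq> k" "m \<noteq> l"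
    by metis
  then show ?thesis
  proof cases
    case 1
    then show ?thesis using assms pat[of "[x, j]" 1 1 1 1]
      by (auto simp: certified coincidence_patterns_def)
  next
    case 2
    then show ?thesis using assms pat[of "[x, j, m]" 1 1 1 2]
      by (auto simp: certified coincidence_patterns_def)
  next
    case 3
    then show ?thesis using assms pat[of "[x, j, l]" 1 1 2 1]
      by (auto simp: certified coincidence_patterns_def)
  next
    case 4
    then show ?thesis using assms pat[of "[x, j, l]" 1 1 2 2]
      by (auto simp: certified coincidence_patterns_def)
  next
    case 5
    then show ?thesis using assms pat[of "[x, j, l, m]" 1 1 2 3]
      by (auto simp: certified coincidence_patterns_def)
  next
    case 6
    then show ?thesis using assms pat[of "[x, j, k]" 1 2 1 1]
      by (auto simp: certified coincidence_patterns_def)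
  next
    case 7
    then show ?thesis using assms pat[of "[x, j, k]" 1 2 1 2]
      by (auto simp: certified coincidence_patterns_def)
  next
    case 8
    then show ?thesis using assms pat[of "[x, j, k, m]" 1 2 1 3]
      by (auto simp: certified coincidence_patterns_def)
  next
    case 9
    then show ?thesis using assms pat[of "[x, j, k]" 1 2 2 1]
      by (auto simp: certified coincidence_patterns_def)
  next
    case 10
    then show ?thesis using assms pat[of "[x, j, k]" 1 2 2 2]
      by (auto simp: certified coincidence_patterns_def)
  next
    case 11
    then show ?thesis using assms pat[of "[x, j, k, m]" 1 2 2 3]
      by (auto simp: certified coincidence_patterns_def)
  next
    case 12
    then show ?thesis using assms pat[of "[x, j, k, l]" 1 2 3 1]
      by (auto simp: certified coincidence_patterns_def)
  next
    case 13
    then show ?thesis using assms pat[of "[x, j, k, l]" 1 2 3 2]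
      by (auto simp: certified coincidence_patterns_def)
  next
    case 14
    then show ?thesis using assms pat[of "[x, j, k, l]" 1 2 3 3]
      by (auto simp: certified coincidence_patterns_def)
  next
    case 15
    then show ?thesis using assms pat[of "[x, j, k, l, m]" 1 2 3 4]
      by (auto simp: certified coincidence_patterns_def)
  qed
qed

lemma perm_inner_sum_left:
  "perm_inner V (\<lambda>\<pi>. \<Sum>i\<in>I. F i \<pi>) g = (\<Sum>i\<in>I. perm_inner V (F i) g)"
  unfolding perm_inner_def sum_distrib_right by (rule sum.swap)

lemma perm_inner_scale_left:
  "perm_inner V (\<lambda>\<pi>. c * f \<pi>) g = c * perm_inner V f g"
  by (simp add: perm_inner_def sum_distrib_left mult.assoc)

text \<open>Permuting the four summation indices leaves the monomial unchanged, so the six terms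
  have equal sums.\<close>

lemma sum_sym_star_form:
  fixes c :: "'a \<Rightarrow> real"
  shows "(\<Sum>(j, k, l, m)\<in>Y \<times> Y \<times> Y \<times> Y. c j * c k * (c l * c m) * sym_star_form V x f j k l m)
    = 6 * (\<Sum>(j, k, l, m)\<in>Y \<times> Y \<times> Y \<times> Y. c j * c k * (c l * c m) * star_form V x f j k l m)"
proof -
  let ?g = "star_form V x f"
  let ?Q = "\<lambda>h. \<Sum>(j, k, l, m)\<in>Y \<times> Y \<times> Y \<times> Y. c j * c k * (c l * c m) * (h j k l m :: real)"
  have "?Q (\<lambda>j k l m. ?g l m j k) = ?Q ?g"
    by (rule sum.reindex_bij_witness[of _ "\<lambda>(j, k, l, m). (l, m, j, k)" "\<lambda>(j, k, l, m). (l, m, j, k)"])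
      (auto simp: ac_simps)
  moreover have "?Q (\<lambda>j k l m. ?g j l k m) = ?Q ?g"
    by (rule sum.reindex_bij_witness[of _ "\<lambda>(j, k, l, m). (j, l, k, m)" "\<lambda>(j, k, l, m). (j, l, k, m)"])
      (auto simp: ac_simps)
  moreover have "?Q (\<lambda>j k l m. ?g k m j l) = ?Q ?g"
    by (rule sum.reindex_bij_witness[of _ "\<lambda>(j, k, l, m). (l, j, m, k)" "\<lambda>(j, k, l, m). (k, m, j, l)"])
      (auto simp: ac_simps)
  moreover have "?Q (\<lambda>j k l m. ?g j m k l) = ?Q ?g"
    by (rule sum.reindex_bij_witness[of _ "\<lambda>(j, k, l, m). (j, l, m, k)" "\<lambda>(j, k, l, m). (j, m, k, l)"])
      (auto simp: ac_simps)
  moreover have "?Q (\<lambda>j k l m. ?g k l j m) = ?Q ?g"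
    by (rule sum.reindex_bij_witness[of _ "\<lambda>(j, k, l, m). (l, j, k, m)" "\<lambda>(j, k, l, m). (k, l, j, m)"])
      (auto simp: ac_simps)
  moreover have "?Q (sym_star_form V x f) = ?Q ?g + ?Q (\<lambda>j k l m. ?g l m j k) + ?Q (\<lambda>j k l m. ?g j l k m)
     + ?Q (\<lambda>j k l m. ?g k m j l) + ?Q (\<lambda>j k l m. ?g j m k l) + ?Q (\<lambda>j k l m. ?g k l j m)"
    by (simp add: sym_star_form_def case_prod_unfold sum.distrib[symmetric] algebra_simps)
  ultimately show ?thesis by simp
qed

lemma sum_quad_cartesian:
  "(\<Sum>(j, k, l, m)\<in>Y \<times> Y \<times> Y \<times> Y. h j k l m) = (\<Sum>j\<in>Y. \<Sum>k\<in>Y. \<Sum>l\<in>Y. \<Sum>m\<in>Y. h j k l m)"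
  by (simp add: sum.cartesian_product)

definition star_sum :: "'a set \<Rightarrow> ('a \<Rightarrow> real) \<Rightarrow> 'a \<Rightarrow> (('a \<Rightarrow> 'a) \<Rightarrow> real) \<Rightarrow> ('a \<Rightarrow> 'a) \<Rightarrow> real" where
  "star_sum Y c x f \<pi> = (\<Sum>j\<in>Y. \<Sum>k\<in>Y. c j * c k * star_op x f j k \<pi>)"

lemma perm_inner_star_sum_right:
  "perm_inner V h (star_sum Y c x f) = (\<Sum>j\<in>Y. \<Sum>k\<in>Y. c j * c k * perm_inner V h (star_op x f j k))"
proof -
  have "perm_inner V (star_sum Y c x f) h
      = perm_inner V (\<lambda>\<pi>. \<Sum>j\<in>Y. \<Sum>k\<in>Y. c j * c k * star_op x f j k \<pi>) h"
    by (simp add: star_sum_def[abs_def])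
  then show ?thesis
    by (simp only: perm_inner_sum_left perm_inner_scale_left perm_inner_commute[of V h])
qed

text \<open>Summed against the monomials, the symmetrized forms bound the squared norm of
  \<open>?w\<close> by \<open>2 * u\<close> times the wanted inner product, which is therefore
  nonnegative when \<open>u > 0\<close>. When \<open>u = 0\<close>, all conductances on
  \<open>Y\<close> vanish.\<close>

lemma star_sum_nonneg:
  assumes "finite V" "x \<in> V" and c: "\<And>j. j \<in> V - {x} \<Longrightarrow> c j \<ge> 0"
  defines "Y \<equiv> V - {x}"
  shows "perm_inner V f (star_sum Y c x f) \<ge> 0"
proof -
  let ?w = "star_sum Y c x f"
  define u where "u = (\<Sum>j\<in>Y. c j)\<^sup>2 + (\<Sum>j\<in>Y. (c j)\<^sup>2)"
  have fin: "finite Y" using assms by simp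
  have "0 \<le> (\<Sum>(j, k, l, m)\<in>Y \<times> Y \<times> Y \<times> Y. c j * c k * (c l * c m) * sym_star_form V x f j k l m)"
    using assms by (intro sum_nonneg) (auto intro!: mult_nonneg_nonneg sym_star_form_nonneg)
  then have "0 \<le> (\<Sum>(j, k, l, m)\<in>Y \<times> Y \<times> Y \<times> Y. c j * c k * (c l * c m) * star_form V x f j k l m)"
    by (simp add: sum_sym_star_form)
  also have "\<dots> = (\<Sum>j\<in>Y. \<Sum>k\<in>Y. \<Sum>l\<in>Y. \<Sum>m\<in>Y. c j * c k * (if j = k then 4 else 2)
        * (c l * c m * perm_inner V f (star_op x f l m)))
     - (\<Sum>j\<in>Y. \<Sum>k\<in>Y. \<Sum>l\<in>Y. \<Sum>m\<in>Y. c j * c k *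
        (c l * c m * perm_inner V (star_op x f j k) (star_op x f l m)))"
    unfolding sum_quad_cartesian star_form_def sum_subtractf[symmetric]
    by (intro sum.cong refl) (simp add: algebra_simps)
  also have "(\<Sum>j\<in>Y. \<Sum>k\<in>Y. \<Sum>l\<in>Y. \<Sum>m\<in>Y. c j * c k * (if j = k then 4 else 2)
        * (c l * c m * perm_inner V f (star_op x f l m)))
      = (\<Sum>j\<in>Y. \<Sum>k\<in>Y. c j * c k * (if j = k then 4 else 2)) * perm_inner V f ?w"
    by (simp only: perm_inner_star_sum_right sum_distrib_left[symmetric] sum_distrib_right[symmetric])
  also have "(\<Sum>j\<in>Y. \<Sum>k\<in>Y. c j * c k * (if j = k then 4 else 2)) = 2 * u"
  proof -
    have "c j * c k * (if j = k then 4 else 2) = 2 * (c j * c k) + (if k = j then 2 * (c j)\<^sup>2 else 0)" for j k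
      by (simp add: power2_eq_square)
    then have "(\<Sum>j\<in>Y. \<Sum>k\<in>Y. c j * c k * (if j = k then 4 else 2))
        = (\<Sum>j\<in>Y. \<Sum>k\<in>Y. 2 * (c j * c k)) + (\<Sum>j\<in>Y. 2 * (c j)\<^sup>2)"
      using fin by (simp add: sum.distrib)
    then show ?thesis
      by (simp add: u_def power2_eq_square[of "sum c Y"] sum_product sum_distrib_left[symmetric])
  qed
  also have "(\<Sum>j\<in>Y. \<Sum>k\<in>Y. \<Sum>l\<in>Y. \<Sum>m\<in>Y. c j * c k *
        (c l * c m * perm_inner V (star_op x f j k) (star_op x f l m))) = perm_inner V ?w ?w"
    by (simp only: perm_inner_star_sum_right perm_inner_commute[of V ?w] sum_distrib_left[symmetric])
  finally have ineq: "perm_inner V ?w ?w \<le> 2 * u * perm_inner V f ?w" by simp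
  have "u \<ge> 0" by (simp add: u_def sum_nonneg)
  show ?thesis
  proof (cases "u = 0")
    case True
    then have "(\<Sum>j\<in>Y. (c j)\<^sup>2) = 0"
      by (simp add: u_def add_nonneg_eq_0_iff sum_nonneg)
    then have "\<forall>j\<in>Y. c j = 0" using fin by (simp add: sum_nonneg_eq_0_iff)
    then show ?thesis by (simp add: perm_inner_star_sum_right)
  next
    case False
    with \<open>u \<ge> 0\<close> have "u > 0" by simp
    moreover have "0 \<le> 2 * u * perm_inner V f ?w"
      using ineq perm_inner_self_nonneg[of V ?w] by linarith
    ultimately show ?thesis by (simp add: zero_le_mult_iff)
  qed
qed

section \<open>Energies of single swaps\<close>

definition swap_energy :: "'a set \<Rightarrow> (('a \<Rightarrow> 'a) \<Rightarrow> real) \<Rightarrow> 'a \<Rightarrow> 'a \<Rightarrow> real" where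
  "swap_energy V f y z = (\<Sum>\<pi> | \<pi> permutes V. (f (transpose y z \<circ> \<pi>) - f \<pi>)\<^sup>2)"

lemma swap_energy_eq:
  assumes "y \<in> V" "z \<in> V"
  shows "swap_energy V f y z = 2 * perm_inner V f f - 2 * autocorr V f (transpose y z)"
proof -
  have "(\<Sum>\<pi> | \<pi> permutes V. (f (transpose y z \<circ> \<pi>))\<^sup>2) = (\<Sum>\<pi> | \<pi> permutes V. (f \<pi>)\<^sup>2)"
    by (rule setum_permutations_compose_left[OF permutes_swap_id[OF assms], symmetric])
  then show ?thesis
    unfolding swap_energy_def autocorr_def perm_inner_def power2_diff
    by (simp add: sum.distrib sum_subtractf sum_distrib_left power2_eq_square ac_simps)
qed

lemma swap_energy_commute: "swap_energy V f y z = swap_energy V f z y"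
  by (simp add: swap_energy_def transpose_commute)

lemma perm_inner_star_op:
  assumes "x \<in> V" "j \<in> V" "k \<in> V"
  shows "perm_inner V f (star_op x f j k)
    = (swap_energy V f x j + swap_energy V f x k - swap_energy V f j k) / 2"
proof -
  have "perm_inner V f (star_op x f j k) = perm_inner V f f + autocorr V f (transpose j k)
      - autocorr V f (transpose x j) - autocorr V f (transpose x k)"
    by (simp add: perm_inner_def autocorr_def star_op_def[abs_def] algebra_simps sum.distrib sum_subtractf)
  then show ?thesis using assms by (simp add: swap_energy_eq)
qed

text \<open>This is \<open>star_sum_nonneg\<close> expressed in swap energies. The left side runs
  over ordered pairs, hence the division by 2; its diagonal terms are zero because a trivial swap
  costs no energy.\<close>

theorem octopus:
  fixes c :: "'a \<Rightarrow> real"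
  assumes "finite V" "x \<in> V" "\<And>j. j \<in> V - {x} \<Longrightarrow> c j \<ge> 0"
  defines "Y \<equiv> V - {x}"
  shows "(\<Sum>j\<in>Y. \<Sum>k\<in>Y. c j * c k * swap_energy V f j k) / 2
    \<le> (\<Sum>j\<in>Y. c j) * (\<Sum>j\<in>Y. c j * swap_energy V f x j)"
proof -
  let ?q = "swap_energy V f"
  have "0 \<le> perm_inner V f (star_sum Y c x f)"
    using star_sum_nonneg[of V x c f] assms by simp
  also have "\<dots> = (\<Sum>j\<in>Y. \<Sum>k\<in>Y. c j * c k * ((?q x j + ?q x k - ?q j k) / 2))"
    unfolding perm_inner_star_sum_right
    using assms by (intro sum.cong refl) (simp add: perm_inner_star_op)
  also have "\<dots> = (\<Sum>j\<in>Y. \<Sum>k\<in>Y. c j * c k * ?q x j) / 2 + (\<Sum>j\<in>Y. \<Sum>k\<in>Y. c j * c k * ?q x k) / 2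
      - (\<Sum>j\<in>Y. \<Sum>k\<in>Y. c j * c k * ?q j k) / 2"
    unfolding sum_divide_distrib sum.distrib[symmetric] sum_subtractf[symmetric]
    by (intro sum.cong refl) (simp add: field_simps)
  also have "(\<Sum>j\<in>Y. \<Sum>k\<in>Y. c j * c k * ?q x k) = (\<Sum>j\<in>Y. c j) * (\<Sum>j\<in>Y. c j * ?q x j)"
    by (simp add: sum_product mult.assoc)
  also have "(\<Sum>j\<in>Y. \<Sum>k\<in>Y. c j * c k * ?q x j) = (\<Sum>j\<in>Y. c j) * (\<Sum>j\<in>Y. c j * ?q x j)"
    by (subst sum.swap) (simp add: sum_product ac_simps)
  finally show ?thesis by simp
qed

section \<open>Minimizers of the Dirichlet form\<close>

text \<open>
  The random walk acts on vertices and the interchange process on permutations; in both cases an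
  edge acts as an involution.
\<close>

locale involution_walk =
  fixes A :: "'b set" and I :: "'e set" and w :: "'e \<Rightarrow> real" and T :: "'e \<Rightarrow> 'b \<Rightarrow> 'b"
  assumes finA: "finite A"
    and T_in: "e \<in> I \<Longrightarrow> a \<in> A \<Longrightarrow> T e a \<in> A"
    and T_T: "e \<in> I \<Longrightarrow> a \<in> A \<Longrightarrow> T e (T e a) = a"
begin

text \<open>This is \<open>2 * \<langle>f, - gen f\<rangle>\<close>, which accounts for the factors \<open>2 * \<mu>\<close> below.\<close>

definition energy :: "('b \<Rightarrow> real) \<Rightarrow> real" where
  "energy f = (\<Sum>e\<in>I. w e * (\<Sum>a\<in>A. (f (T e a) - f a)\<^sup>2))"

definition polar :: "('b \<Rightarrow> real) \<Rightarrow> ('b \<Rightarrow> real) \<Rightarrow> real" where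
  "polar f g = (\<Sum>e\<in>I. w e * (\<Sum>a\<in>A. (f (T e a) - f a) * (g (T e a) - g a)))"

definition gen :: "('b \<Rightarrow> real) \<Rightarrow> 'b \<Rightarrow> real" where
  "gen f a = (\<Sum>e\<in>I. w e * (f (T e a) - f a))"

lemma sum_T: "e \<in> I \<Longrightarrow> (\<Sum>a\<in>A. h (T e a)) = (\<Sum>a\<in>A. h a)"
  by (rule sum.reindex_bij_witness[of _ "T e" "T e"]) (auto simp: T_in T_T)

lemma energy_polar: "energy f = polar f f"
  by (simp add: energy_def polar_def power2_eq_square)

text \<open>Summation by parts: as \<open>T e\<close> is an involution of \<open>A\<close>, the two
  ends of each jump contribute equally.\<close>

lemma polar_gen: "polar f g = - 2 * (\<Sum>a\<in>A. g a * gen f a)"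
proof -
  have "(\<Sum>a\<in>A. (f (T e a) - f a) * (g (T e a) - g a)) = - 2 * (\<Sum>a\<in>A. g a * (f (T e a) - f a))"
    if e: "e \<in> I" for e
  proof -
    have "(\<Sum>a\<in>A. (f (T e a) - f a) * g (T e a)) = (\<Sum>a\<in>A. (f (T e (T e a)) - f (T e a)) * g (T e (T e a)))"
      using sum_T[OF e, of "\<lambda>a. (f (T e a) - f a) * g (T e a)"] by simp
    also have "\<dots> = (\<Sum>a\<in>A. (f a - f (T e a)) * g a)"
      using e by (intro sum.cong refl) (simp add: T_T)
    finally show ?thesis
      by (simp add: algebra_simps sum.distrib sum_subtractf)
  qed
  then have "polar f g = (\<Sum>e\<in>I. \<Sum>a\<in>A. - 2 * (g a * (w e * (f (T e a) - f a))))"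
    unfolding polar_def by (intro sum.cong refl) (simp add: sum_distrib_left algebra_simps)
  also have "\<dots> = (\<Sum>a\<in>A. \<Sum>e\<in>I. - 2 * (g a * (w e * (f (T e a) - f a))))"
    by (rule sum.swap)
  finally show ?thesis
    by (simp add: gen_def sum_distrib_left sum_negf)
qed

lemma energy_gen: "energy f = - 2 * (\<Sum>a\<in>A. f a * gen f a)"
  by (simp add: energy_polar polar_gen)

lemma sum_gen: "(\<Sum>a\<in>A. gen f a) = 0"
  using polar_gen[of f "\<lambda>_. 1"] by (simp add: polar_def)

lemma energy_cong: "(\<And>a. a \<in> A \<Longrightarrow> f a = g a) \<Longrightarrow> energy f = energy g"
  unfolding energy_def by (intro sum.cong arg_cong2[of _ _ _ _ "(*)"] refl) (simp add: T_in)

lemma energy_scale: "energy (\<lambda>a. k * f a) = k\<^sup>2 * energy f"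
  by (simp add: energy_def right_diff_distrib[symmetric] power_mult_distrib sum_distrib_left ac_simps)

lemma energy_add_scaled:
  "energy (\<lambda>a. f a + t * g a) = energy f + 2 * t * polar f g + t\<^sup>2 * energy g"
proof -
  have sq: "(f (T e a) + t * g (T e a) - (f a + t * g a))\<^sup>2
      = (f (T e a) - f a)\<^sup>2 + 2 * t * ((f (T e a) - f a) * (g (T e a) - g a)) + t\<^sup>2 * (g (T e a) - g a)\<^sup>2" for e a
    by (simp add: power2_eq_square algebra_simps)
  show ?thesis
    unfolding energy_def polar_def sq by (simp add: sum.distrib sum_distrib_left distrib_left ac_simps)
qed

text \<open>With the coordinates outside \<open>A\<close> fixed at 0, which does not affect the
  energy, the constraint set is closed in a product of compact sets, hence compact.\<close>

lemma energy_attains_min: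
  assumes "card A \<ge> 2"
  obtains f where "(\<Sum>a\<in>A. f a) = 0" "(\<Sum>a\<in>A. (f a)\<^sup>2) = 1"
    "\<And>g. (\<Sum>a\<in>A. g a) = 0 \<Longrightarrow> (\<Sum>a\<in>A. (g a)\<^sup>2) = 1 \<Longrightarrow> energy f \<le> energy g"
proof -
  define B where "B = (\<Pi>\<^sub>E a\<in>UNIV. if a \<in> A then {-1..1::real} else {0})"
  define K where "K = B \<inter> {f. (\<Sum>a\<in>A. f a) = 0} \<inter> {f. (\<Sum>a\<in>A. (f a)\<^sup>2) = 1}"
  have "compactin (product_topology (\<lambda>_. euclidean) UNIV) B"
    unfolding B_def compactin_PiE by (auto simp: compactin_euclidean_iff)
  then have "compact B"
    by (simp add: euclidean_product_topology compactin_euclidean_iff)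
  moreover have "closed {f::'b \<Rightarrow> real. (\<Sum>a\<in>A. f a) = 0}" "closed {f::'b \<Rightarrow> real. (\<Sum>a\<in>A. (f a)\<^sup>2) = 1}"
    by (intro closed_Collect_eq continuous_intros continuous_on_product_coordinates)+
  ultimately have "compact K" unfolding K_def by (intro compact_Int_closed)
  have clip: "\<exists>g'\<in>K. energy g' = energy g" if g: "(\<Sum>a\<in>A. g a) = 0" "(\<Sum>a\<in>A. (g a)\<^sup>2) = 1" for g
  proof
    let ?g = "\<lambda>a. if a \<in> A then g a else 0"
    have "\<bar>g a\<bar> \<le> 1" if "a \<in> A" for a
    proof -
      have "(g a)\<^sup>2 \<le> (\<Sum>a\<in>A. (g a)\<^sup>2)" using that finA by (intro member_le_sum) auto
      then show ?thesis using g(2) by (simp add: abs_square_le_1)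
    qed
    then show "?g \<in> K" using g by (fastforce simp: K_def B_def abs_le_iff)
    show "energy ?g = energy g" by (rule energy_cong) simp
  qed
  have "K \<noteq> {}"
  proof -
    have "\<not> card A \<le> Suc 0" using assms by simp
    then obtain a b where ab: "a \<in> A" "b \<in> A" "a \<noteq> b"
      unfolding card_le_Suc0_iff_eq[OF finA] by blast
    \<comment> \<open>A normalized difference of two point masses shows that the constraint set is
      inhabited.\<close>
    define g where "g v = (if v = a then 1 / sqrt 2 else 0) - (if v = b then 1 / sqrt 2 else (0::real))" for v
    have "(g v)\<^sup>2 = (if v = a then 1 / 2 else 0) + (if v = b then 1 / 2 else 0)" for v
      using ab by (simp add: g_def power_divide)
    then have "(\<Sum>v\<in>A. g v) = 0" "(\<Sum>v\<in>A. (g v)\<^sup>2) = 1"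
      using ab finA by (simp_all add: sum.distrib) (simp add: g_def sum_subtractf)
    then show ?thesis using clip by blast
  qed
  moreover have "continuous_on K energy"
    unfolding energy_def
    by (intro continuous_intros continuous_on_subset[OF continuous_on_product_coordinates]) auto
  ultimately obtain f where f: "f \<in> K" "\<forall>g\<in>K. energy f \<le> energy g"
    using continuous_attains_inf[OF \<open>compact K\<close>] by blast
  show thesis
  proof (rule that)
    show "(\<Sum>a\<in>A. f a) = 0" "(\<Sum>a\<in>A. (f a)\<^sup>2) = 1"
      using f(1) by (simp_all add: K_def)
    show "energy f \<le> energy g" if "(\<Sum>a\<in>A. g a) = 0" "(\<Sum>a\<in>A. (g a)\<^sup>2) = 1" for g
      using clip[OF that] f(2) by metis
  qed
qed

text \<open>First variation of the Rayleigh quotient: a constrained minimizer is an eigenfunction,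
  with eigenvalue half its energy.\<close>

lemma energy_minimizer:
  assumes "card A \<ge> 2"
  obtains f \<mu> where "(\<Sum>a\<in>A. f a) = 0" "(\<Sum>a\<in>A. (f a)\<^sup>2) = 1" "energy f = 2 * \<mu>"
    "\<And>g. (\<Sum>a\<in>A. g a) = 0 \<Longrightarrow> 2 * \<mu> * (\<Sum>a\<in>A. (g a)\<^sup>2) \<le> energy g"
    "\<And>a. a \<in> A \<Longrightarrow> gen f a = - \<mu> * f a"
proof -
  obtain f where f: "(\<Sum>a\<in>A. f a) = 0" "(\<Sum>a\<in>A. (f a)\<^sup>2) = 1"
    and min: "\<And>g. (\<Sum>a\<in>A. g a) = 0 \<Longrightarrow> (\<Sum>a\<in>A. (g a)\<^sup>2) = 1 \<Longrightarrow> energy f \<le> energy g"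
    using energy_attains_min[OF assms] by blast
  define \<mu> where "\<mu> = energy f / 2"
  have bound: "2 * \<mu> * (\<Sum>a\<in>A. (g a)\<^sup>2) \<le> energy g" if g: "(\<Sum>a\<in>A. g a) = 0" for g
  proof (cases "(\<Sum>a\<in>A. (g a)\<^sup>2) = 0")
    case True
    then have "\<forall>a\<in>A. g a = 0" using finA by (simp add: sum_nonneg_eq_0_iff)
    then have "energy g = energy (\<lambda>a. 0)" by (intro energy_cong) auto
    then show ?thesis using True by (simp add: energy_def)
  next
    case False
    define s where "s = (\<Sum>a\<in>A. (g a)\<^sup>2)"
    have s: "s > 0" using False by (simp add: s_def sum_nonneg less_le)
    have "(\<Sum>a\<in>A. inverse (sqrt s) * g a) = 0" "(\<Sum>a\<in>A. (inverse (sqrt s) * g a)\<^sup>2) = 1"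
      using g s by (simp_all add: sum_distrib_left[symmetric] power_mult_distrib power_inverse s_def[symmetric])
    from min[OF this] have "energy f \<le> energy g / s"
      unfolding energy_scale using s by (simp add: power_inverse field_simps)
    then show ?thesis using s by (simp add: \<mu>_def s_def[symmetric] field_simps)
  qed
  \<comment> \<open>The residual of the eigenvalue equation serves as the direction of perturbation;
    the linear coefficient \<open>b\<close> turns out to be minus twice its squared norm.\<close>
  define h where "h a = gen f a + \<mu> * f a" for a
  have sumh: "(\<Sum>a\<in>A. h a) = 0"
    using f by (simp add: h_def sum.distrib sum_gen sum_distrib_left[symmetric])
  define b where "b = polar f h - 2 * \<mu> * (\<Sum>a\<in>A. f a * h a)"
  define d where "d = energy h - 2 * \<mu> * (\<Sum>a\<in>A. (h a)\<^sup>2)"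
  have quad: "0 \<le> 2 * t * b + t\<^sup>2 * d" for t
  proof -
    have "(\<Sum>a\<in>A. f a + t * h a) = 0"
      using f sumh by (simp add: sum.distrib sum_distrib_left[symmetric])
    from bound[OF this]
    have "2 * \<mu> * (\<Sum>a\<in>A. (f a + t * h a)\<^sup>2) \<le> energy f + 2 * t * polar f h + t\<^sup>2 * energy h"
      by (simp add: energy_add_scaled)
    moreover have "(\<Sum>a\<in>A. (f a + t * h a)\<^sup>2)
        = (\<Sum>a\<in>A. (f a)\<^sup>2) + 2 * t * (\<Sum>a\<in>A. f a * h a) + t\<^sup>2 * (\<Sum>a\<in>A. (h a)\<^sup>2)"
      by (simp add: power2_sum power_mult_distrib sum.distrib sum_distrib_left algebra_simps)
    ultimately show ?thesis using f by (simp add: b_def d_def \<mu>_def algebra_simps)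
  qed
  have "b = 0"
  proof (rule ccontr)
    assume "b \<noteq> 0"
    \<comment> \<open>Since \<open>n\<close> is positive and at least \<open>d\<close>, the choice
      of \<open>t\<close> makes the quadratic at most \<open>- b\<^sup>2 / n\<close>, which is
      negative.\<close>
    define n where "n = \<bar>d\<bar> + 1"
    define t where "t = - b / n"
    have n: "n > 0" "d \<le> n" by (simp_all add: n_def)
    have "2 * t * b + t\<^sup>2 * d \<le> 2 * t * b + t\<^sup>2 * n"
      using n by (intro add_left_mono mult_left_mono) auto
    also have "\<dots> = - b\<^sup>2 / n"
      using n(1) by (simp add: t_def power2_eq_square field_simps)
    also have "\<dots> < 0" using \<open>b \<noteq> 0\<close> n(1) by (simp add: divide_neg_pos)
    finally show False using quad[of t] by simp
  qed
  moreover have "b = - 2 * (\<Sum>a\<in>A. (h a)\<^sup>2)"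
    unfolding b_def polar_gen sum_distrib_left sum_subtractf[symmetric]
    by (intro sum.cong refl) (simp add: h_def power2_eq_square algebra_simps)
  ultimately have "\<forall>a\<in>A. h a = 0" using finA by (simp add: sum_nonneg_eq_0_iff)
  then have "gen f a = - \<mu> * f a" if "a \<in> A" for a
    using that by (simp add: h_def add_eq_0_iff)
  with that[of f \<mu>] f bound show thesis by (simp add: \<mu>_def)
qed

end

text \<open>The quadratic form, the norm and the mean condition split into real and imaginary parts,
  so a real minimizer also gives the minimum over complex functions.\<close>

lemma spectral_gap_eq:
  fixes \<Omega> :: "('b \<Rightarrow> complex) \<Rightarrow> 'b \<Rightarrow> complex"
  assumes "involution_walk A I T" and \<Omega>: "\<And>f a. a \<in> A \<Longrightarrow> \<Omega> f a = (\<Sum>e\<in>I. f (T e a) - f a)"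
    and f: "(\<Sum>a\<in>A. f a) = 0" "(\<Sum>a\<in>A. (f a)\<^sup>2) = 1"
    and \<mu>: "involution_walk.energy A I (\<lambda>_. 1) T f = 2 * \<mu>"
    and bound: "\<And>g. (\<Sum>a\<in>A. g a) = 0 \<Longrightarrow> 2 * \<mu> * (\<Sum>a\<in>A. (g a)\<^sup>2) \<le> involution_walk.energy A I (\<lambda>_. 1) T g"
  shows "spectral_gap A \<Omega> = \<mu>"
proof -
  interpret involution_walk A I "\<lambda>_. 1" T by fact
  have form: "Re (l2_inner A F (\<lambda>a. - \<Omega> F a)) = (energy (\<lambda>a. Re (F a)) + energy (\<lambda>a. Im (F a))) / 2" for F
  proof -
    have "Re (\<Omega> F a) = gen (\<lambda>a. Re (F a)) a" "Im (\<Omega> F a) = gen (\<lambda>a. Im (F a)) a" if "a \<in> A" for a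
      using that by (simp_all add: \<Omega> gen_def)
    then show ?thesis
      by (simp add: l2_inner_def energy_gen sum_negf sum.distrib sum_subtractf)
  qed
  have norm: "l2_norm A F = 1 \<longleftrightarrow> (\<Sum>a\<in>A. (Re (F a))\<^sup>2) + (\<Sum>a\<in>A. (Im (F a))\<^sup>2) = 1" for F
    by (simp add: l2_norm_def l2_inner_def power2_eq_square sum.distrib[symmetric])
  have mean: "l2_inner A F (\<lambda>_. 1) = 0 \<longleftrightarrow> (\<Sum>a\<in>A. Re (F a)) = 0 \<and> (\<Sum>a\<in>A. Im (F a)) = 0" for F
    by (simp add: l2_inner_def complex_eq_iff)
  show ?thesis
    unfolding spectral_gap_def
  proof (rule Least_equality)
    have "energy (\<lambda>a. 0) = 0" by (simp add: energy_def)
    then show "\<mu> \<in> {Re (l2_inner A f (\<lambda>a. - \<Omega> f a)) |f. l2_norm A f = 1 \<and> l2_inner A f (\<lambda>_. 1) = 0}"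
      using f \<mu> by (auto simp: form norm mean intro!: exI[of _ "\<lambda>a. complex_of_real (f a)"])
  next
    fix y assume "y \<in> {Re (l2_inner A f (\<lambda>a. - \<Omega> f a)) |f. l2_norm A f = 1 \<and> l2_inner A f (\<lambda>_. 1) = 0}"
    then obtain F where y: "y = (energy (\<lambda>a. Re (F a)) + energy (\<lambda>a. Im (F a))) / 2"
      and n: "(\<Sum>a\<in>A. (Re (F a))\<^sup>2) + (\<Sum>a\<in>A. (Im (F a))\<^sup>2) = 1"
      and z: "(\<Sum>a\<in>A. Re (F a)) = 0" "(\<Sum>a\<in>A. Im (F a)) = 0"
      by (auto simp: form norm mean)
    have "2 * \<mu> * ((\<Sum>a\<in>A. (Re (F a))\<^sup>2) + (\<Sum>a\<in>A. (Im (F a))\<^sup>2))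
        \<le> energy (\<lambda>a. Re (F a)) + energy (\<lambda>a. Im (F a))"
      unfolding distrib_left using bound[OF z(1)] bound[OF z(2)] by linarith
    then have "2 * \<mu> \<le> energy (\<lambda>a. Re (F a)) + energy (\<lambda>a. Im (F a))"
      unfolding n by simp
    then show "\<mu> \<le> y" by (simp add: y)
  qed
qed

section \<open>Removing a vertex\<close>

text \<open>Both forms sum over ordered pairs, so that every edge is counted twice.\<close>

definition rw_form :: "'a set \<Rightarrow> ('a \<Rightarrow> 'a \<Rightarrow> real) \<Rightarrow> ('a \<Rightarrow> real) \<Rightarrow> real" where
  "rw_form V c \<phi> = (\<Sum>y\<in>V. \<Sum>z\<in>V. c y z * (\<phi> y - \<phi> z)\<^sup>2)"

definition ip_form :: "'a set \<Rightarrow> ('a \<Rightarrow> 'a \<Rightarrow> real) \<Rightarrow> (('a \<Rightarrow> 'a) \<Rightarrow> real) \<Rightarrow> real" where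
  "ip_form V c f = (\<Sum>y\<in>V. \<Sum>z\<in>V. c y z * swap_energy V f y z)"

text \<open>
  The electrical network reduction that eliminates the vertex \<open>x\<close>. If \<open>x\<close> is isolated, division
  by \<open>0\<close> makes the additional conductances vanish, as it should.
\<close>

definition reduced :: "'a set \<Rightarrow> 'a \<Rightarrow> ('a \<Rightarrow> 'a \<Rightarrow> real) \<Rightarrow> 'a \<Rightarrow> 'a \<Rightarrow> real" where
  "reduced V x c y z = c y z + c x y * c x z / (\<Sum>v\<in>V - {x}. c x v)"

lemma involution_walk_perms:
  assumes "finite V" "\<And>y z. (y, z) \<in> I \<Longrightarrow> y \<in> V \<and> z \<in> V"
  shows "involution_walk {\<pi>. \<pi> permutes V} I (\<lambda>(y, z) \<pi>. transpose y z \<circ> \<pi>)"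
proof
  fix e \<pi> assume "e \<in> I" "\<pi> \<in> {\<pi>. \<pi> permutes V}"
  then show "(case e of (y, z) \<Rightarrow> \<lambda>\<pi>. transpose y z \<circ> \<pi>) \<pi> \<in> {\<pi>. \<pi> permutes V}"
    using assms(2) by (cases e) (auto intro!: permutes_compose permutes_swap_id)
qed (auto simp: assms finite_permutations fun_eq_iff)

lemma involution_walk_vertices:
  assumes "finite V" "\<And>y z. (y, z) \<in> I \<Longrightarrow> y \<in> V \<and> z \<in> V"
  shows "involution_walk V I (\<lambda>(y, z). transpose y z)"
  using assms by unfold_locales (auto simp: transpose_def)

lemma sum_transpose_diff_square:
  fixes \<phi> :: "'a \<Rightarrow> real"
  assumes "finite V" "y \<in> V" "z \<in> V"
  shows "(\<Sum>a\<in>V. (\<phi> (transpose y z a) - \<phi> a)\<^sup>2) = 2 * (\<phi> y - \<phi> z)\<^sup>2"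
proof -
  have "(\<Sum>a\<in>V. (\<phi> (transpose y z a) - \<phi> a)\<^sup>2) = (\<Sum>a\<in>{y, z}. (\<phi> (transpose y z a) - \<phi> a)\<^sup>2)"
    using assms by (intro sum.mono_neutral_right) auto
  then show ?thesis by (cases "y = z") (auto simp: power2_commute)
qed

lemma swap_energy_nonneg: "swap_energy V f y z \<ge> 0"
  by (simp add: swap_energy_def sum_nonneg)

lemma sum_pairs_remove:
  fixes G :: "'a \<Rightarrow> 'a \<Rightarrow> real"
  assumes "finite V" "x \<in> V" "G x x = 0" "\<And>v. v \<in> V \<Longrightarrow> G v x = G x v"
  shows "(\<Sum>y\<in>V. \<Sum>z\<in>V. G y z) = (\<Sum>y\<in>V - {x}. \<Sum>z\<in>V - {x}. G y z) + 2 * (\<Sum>v\<in>V - {x}. G x v)"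
proof -
  have "(\<Sum>y\<in>V - {x}. G y x) = (\<Sum>v\<in>V - {x}. G x v)"
    by (intro sum.cong refl assms(4)) simp
  then show ?thesis
    using assms(1-3) by (simp add: sum.remove[of V x] sum.distrib)
qed

text \<open>Star-mesh identity: the left side is the pairwise form of a weighted variance, and the
  weighted mean \<open>h\<close> is the harmonic value at the centre of the star.\<close>

lemma rw_form_remove_star:
  fixes c \<phi> :: "'a \<Rightarrow> real"
  assumes "finite Y" "\<And>v. v \<in> Y \<Longrightarrow> c v \<ge> 0"
  defines "C \<equiv> (\<Sum>v\<in>Y. c v)"
  defines "h \<equiv> (\<Sum>v\<in>Y. c v * \<phi> v) / C"
  shows "(\<Sum>y\<in>Y. \<Sum>z\<in>Y. c y * c z / C * (\<phi> y - \<phi> z)\<^sup>2) = 2 * (\<Sum>v\<in>Y. c v * (h - \<phi> v)\<^sup>2)"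
proof (cases "C = 0")
  case True
  then have "\<forall>v\<in>Y. c v = 0" using assms by (simp add: sum_nonneg_eq_0_iff)
  then show ?thesis by simp
next
  case False
  define M where "M = (\<Sum>v\<in>Y. c v * \<phi> v)"
  define S where "S = (\<Sum>v\<in>Y. c v * (\<phi> v)\<^sup>2)"
  have "(\<Sum>y\<in>Y. \<Sum>z\<in>Y. c y * c z / C * (\<phi> y - \<phi> z)\<^sup>2)
      = (\<Sum>y\<in>Y. \<Sum>z\<in>Y. (c y * (\<phi> y)\<^sup>2) * c z + c y * (c z * (\<phi> z)\<^sup>2) - 2 * ((c y * \<phi> y) * (c z * \<phi> z))) / C"
    by (simp add: sum_divide_distrib power2_eq_square algebra_simps diff_divide_distrib add_divide_distrib)
  also have "\<dots> = (S * C + C * S - 2 * (M * M)) / C"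
    by (simp only: S_def M_def C_def sum_product sum.distrib sum_subtractf) (simp only: sum_distrib_left)
  also have "\<dots> = 2 * (S - M * M / C)" using False by (simp add: field_simps)
  also have "\<dots> = 2 * (h * h * C - 2 * h * M + S)"
  proof -
    have M: "M = h * C" using False by (simp add: h_def M_def)
    show ?thesis unfolding M using False by (simp add: field_simps)
  qed
  also have "h * h * C - 2 * h * M + S = (\<Sum>v\<in>Y. c v * (h - \<phi> v)\<^sup>2)"
    by (simp add: S_def M_def C_def sum_distrib_left power2_eq_square algebra_simps sum.distrib sum_subtractf)
  finally show ?thesis .
qed

text \<open>
  The harmonic extension of \<open>\<phi>\<close> to \<open>x\<close> preserves the energy, and centring it again does not bring
  its norm below that of \<open>\<phi>\<close>.
\<close>

lemma rw_gap_reduced: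
  assumes "finite V" "x \<in> V"
    and c_sym: "\<And>y z. y \<in> V \<Longrightarrow> z \<in> V \<Longrightarrow> c y z = c z y"
    and c_nonneg: "\<And>y z. y \<in> V \<Longrightarrow> z \<in> V \<Longrightarrow> c y z \<ge> 0"
    and "\<gamma> \<ge> 0"
    and gap: "\<And>\<phi>. (\<Sum>v\<in>V. \<phi> v) = 0 \<Longrightarrow> \<gamma> * (\<Sum>v\<in>V. (\<phi> v)\<^sup>2) \<le> rw_form V c \<phi>"
    and mean: "(\<Sum>v\<in>V - {x}. \<phi> v) = 0"
  shows "\<gamma> * (\<Sum>v\<in>V - {x}. (\<phi> v)\<^sup>2) \<le> rw_form (V - {x}) (reduced V x c) \<phi>"
proof -
  let ?Y = "V - {x}"
  define h where "h = (\<Sum>v\<in>?Y. c x v * \<phi> v) / (\<Sum>v\<in>?Y. c x v)"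
  define n where "n = real (card V)"
  have n: "n \<ge> 1" using assms(1,2) by (simp add: n_def Suc_le_eq card_gt_0_iff) (auto)
  \<comment> \<open>As \<open>\<phi>\<close> has sum zero, its extension by \<open>h\<close> has sum
    \<open>h\<close>, and subtracting \<open>h / n\<close> restores mean zero.\<close>
  define \<psi> where "\<psi> v = (if v = x then h else \<phi> v) - h / n" for v
  have sum0: "(\<Sum>v\<in>V. \<psi> v) = 0"
    using assms(1,2) mean n
    by (simp add: \<psi>_def sum.remove[of V x] sum_subtractf) (auto simp: n_def)
  have "(\<Sum>v\<in>?Y. (\<phi> v)\<^sup>2) \<le> (\<Sum>v\<in>V. (\<psi> v)\<^sup>2)"
  proof -
    have "(\<Sum>v\<in>?Y. (\<phi> v - k)\<^sup>2) = (\<Sum>v\<in>?Y. (\<phi> v)\<^sup>2) - 2 * k * (\<Sum>v\<in>?Y. \<phi> v) + real (card ?Y) * k\<^sup>2" for k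
      by (simp add: power2_diff sum.distrib sum_subtractf sum_distrib_left ac_simps)
    moreover have "real (card ?Y) = n - 1"
      using assms(1,2) n by (simp add: n_def of_nat_diff)
    ultimately have "(\<Sum>v\<in>?Y. (\<phi> v - h / n)\<^sup>2) = (\<Sum>v\<in>?Y. (\<phi> v)\<^sup>2) + (n - 1) * (h / n)\<^sup>2"
      using mean by simp
    then have "(\<Sum>v\<in>V. (\<psi> v)\<^sup>2) = (h - h / n)\<^sup>2 + (\<Sum>v\<in>?Y. (\<phi> v)\<^sup>2) + (n - 1) * (h / n)\<^sup>2"
      using assms(1,2) mean by (simp add: \<psi>_def sum.remove[of V x])
    then show ?thesis using n by simp
  qed
  then have "\<gamma> * (\<Sum>v\<in>?Y. (\<phi> v)\<^sup>2) \<le> \<gamma> * (\<Sum>v\<in>V. (\<psi> v)\<^sup>2)"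
    using \<open>\<gamma> \<ge> 0\<close> by (rule mult_left_mono)
  also have "\<dots> \<le> rw_form V c \<psi>" by (rule gap[OF sum0])
  also have "\<dots> = (\<Sum>y\<in>?Y. \<Sum>z\<in>?Y. c y z * (\<psi> y - \<psi> z)\<^sup>2) + 2 * (\<Sum>v\<in>?Y. c x v * (\<psi> x - \<psi> v)\<^sup>2)"
    unfolding rw_form_def
    by (rule sum_pairs_remove[OF assms(1,2)]) (simp_all add: c_sym[OF _ assms(2)] power2_commute[of "\<psi> x"])
  also have "\<dots> = (\<Sum>y\<in>?Y. \<Sum>z\<in>?Y. c y z * (\<phi> y - \<phi> z)\<^sup>2) + 2 * (\<Sum>v\<in>?Y. c x v * (h - \<phi> v)\<^sup>2)"
    by (intro arg_cong2[of _ _ _ _ "(+)"] arg_cong2[of _ _ _ _ "(*)"] sum.cong refl) (auto simp: \<psi>_def)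
  also have "2 * (\<Sum>v\<in>?Y. c x v * (h - \<phi> v)\<^sup>2)
      = (\<Sum>y\<in>?Y. \<Sum>z\<in>?Y. c x y * c x z / (\<Sum>v\<in>?Y. c x v) * (\<phi> y - \<phi> z)\<^sup>2)"
    unfolding h_def using assms by (intro rw_form_remove_star[symmetric]) auto
  also have "(\<Sum>y\<in>?Y. \<Sum>z\<in>?Y. c y z * (\<phi> y - \<phi> z)\<^sup>2) + \<dots> = rw_form ?Y (reduced V x c) \<phi>"
    by (simp add: rw_form_def reduced_def distrib_right sum.distrib)
  finally show ?thesis .
qed

text \<open>Removing \<open>x\<close> loses the energy of its star and gains \<open>R / C\<close>
  from the added conductances; the octopus inequality divided by \<open>C\<close> bounds the gain by
  the loss.\<close>

lemma ip_form_reduced: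
  assumes "finite V" "x \<in> V"
    and c_sym: "\<And>y z. y \<in> V \<Longrightarrow> z \<in> V \<Longrightarrow> c y z = c z y"
    and c_nonneg: "\<And>y z. y \<in> V \<Longrightarrow> z \<in> V \<Longrightarrow> c y z \<ge> 0"
  shows "(\<Sum>y\<in>V - {x}. \<Sum>z\<in>V - {x}. reduced V x c y z * swap_energy V f y z) \<le> ip_form V c f"
proof -
  let ?Y = "V - {x}" and ?q = "swap_energy V f"
  define C where "C = (\<Sum>v\<in>?Y. c x v)"
  define R where "R = (\<Sum>y\<in>?Y. \<Sum>z\<in>?Y. c x y * c x z * ?q y z)"
  have "C \<ge> 0" using assms by (auto simp: C_def intro!: sum_nonneg)
  have pos: "0 \<le> (\<Sum>v\<in>?Y. c x v * ?q x v)"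
    using assms by (auto intro!: sum_nonneg mult_nonneg_nonneg swap_energy_nonneg)
  have "R / 2 \<le> C * (\<Sum>v\<in>?Y. c x v * ?q x v)"
    unfolding C_def R_def using assms by (intro octopus) auto
  then have "R / C \<le> 2 * (\<Sum>v\<in>?Y. c x v * ?q x v)"
    using \<open>C \<ge> 0\<close> pos by (cases "C = 0") (auto simp: field_simps)
  moreover have "ip_form V c f = (\<Sum>y\<in>?Y. \<Sum>z\<in>?Y. c y z * ?q y z) + 2 * (\<Sum>v\<in>?Y. c x v * ?q x v)"
    unfolding ip_form_def
  proof (rule sum_pairs_remove[OF assms(1,2)])
    show "c x x * ?q x x = 0" by (simp add: swap_energy_def)
    show "c v x * ?q v x = c x v * ?q x v" if "v \<in> V" for v
      using c_sym[OF that assms(2)] swap_energy_commute[of V f v x] by simp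
  qed
  moreover have "(\<Sum>y\<in>?Y. \<Sum>z\<in>?Y. reduced V x c y z * ?q y z) = (\<Sum>y\<in>?Y. \<Sum>z\<in>?Y. c y z * ?q y z) + R / C"
    by (simp add: reduced_def R_def C_def distrib_right sum.distrib sum_divide_distrib)
  ultimately show ?thesis by simp
qed

text \<open>Splits the permutations by the element \<open>i\<close> that is sent to
  \<open>x\<close>. Inversion moves the transposition of \<open>sum_over_permutations_insert\<close>
  from the left to the right.\<close>

lemma sum_permutations_remove:
  fixes h :: "('a \<Rightarrow> 'a) \<Rightarrow> real"
  assumes "finite V" "x \<in> V"
  shows "(\<Sum>\<pi> | \<pi> permutes V. h \<pi>) = (\<Sum>i\<in>V. \<Sum>\<sigma> | \<sigma> permutes V - {x}. h (\<sigma> \<circ> transpose x i))"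
proof -
  have V: "insert x (V - {x}) = V" using assms by auto
  have "(\<Sum>\<pi> | \<pi> permutes V. h \<pi>) = (\<Sum>\<pi> | \<pi> permutes V. h (inv \<pi>))"
    by (rule sum_permutations_inverse)
  also have "\<dots> = (\<Sum>i\<in>V. \<Sum>\<sigma> | \<sigma> permutes V - {x}. h (inv (transpose x i \<circ> \<sigma>)))"
    using sum_over_permutations_insert[of "V - {x}" x "\<lambda>\<pi>. h (inv \<pi>)"] assms unfolding V by simp
  also have "\<dots> = (\<Sum>i\<in>V. \<Sum>\<sigma> | \<sigma> permutes V - {x}. h (inv \<sigma> \<circ> transpose x i))"
    by (intro sum.cong refl) (auto simp: o_inv_distrib bij_transpose permutes_bij)
  also have "\<dots> = (\<Sum>i\<in>V. \<Sum>\<sigma> | \<sigma> permutes V - {x}. h (\<sigma> \<circ> transpose x i))"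
    by (intro sum.cong refl sum_permutations_inverse[symmetric])
  finally show ?thesis .
qed

text \<open>Swaps compose on the left and the splitting on the right, so the two do not
  interfere.\<close>

lemma swap_energy_remove:
  assumes "finite V" "x \<in> V"
  shows "swap_energy V f y z = (\<Sum>i\<in>V. swap_energy (V - {x}) (\<lambda>\<sigma>. f (\<sigma> \<circ> transpose x i)) y z)"
  unfolding swap_energy_def sum_permutations_remove[OF assms] by (simp only: comp_assoc)

section \<open>The spectral gap of the interchange process\<close>

lemma perms_small:
  assumes "finite V" "card V \<le> 1"
  shows "{\<pi>. \<pi> permutes V} = {id}"
proof -
  have "card V = 0 \<or> card V = 1" using assms(2) by linarith
  then show ?thesis
    using assms(1) by (auto simp: card_1_singleton_iff)
qed

lemma sum_of_bool_eq:
  fixes h :: "'a \<Rightarrow> real"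
  assumes "finite V" "v \<in> V"
  shows "(\<Sum>y\<in>V. h y * of_bool (v = y)) = h v"
proof -
  have "h y * of_bool (v = y) = (if y = v then h y else 0)" for y by simp
  then show ?thesis using assms by simp
qed

lemma ip_form_nonneg:
  "(\<And>y z. y \<in> V \<Longrightarrow> z \<in> V \<Longrightarrow> c y z \<ge> 0) \<Longrightarrow> ip_form V c f \<ge> 0"
  unfolding ip_form_def by (intro sum_nonneg mult_nonneg_nonneg swap_energy_nonneg)

text \<open>Both inequalities bound a gap below by \<open>\<gamma> / 2\<close>: ordered pairs make
  \<open>rw_form\<close> twice the Dirichlet form of the generator, and \<open>ip_form\<close> is
  four times its own, because a swap energy also counts each jump from both ends.\<close>

theorem interchange_gap:
  assumes "finite V"
    and "\<And>y z. y \<in> V \<Longrightarrow> z \<in> V \<Longrightarrow> c y z = c z y"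
    and "\<And>y z. y \<in> V \<Longrightarrow> z \<in> V \<Longrightarrow> c y z \<ge> 0"
    and "\<And>\<phi>. (\<Sum>v\<in>V. \<phi> v) = 0 \<Longrightarrow> \<gamma> * (\<Sum>v\<in>V. (\<phi> v)\<^sup>2) \<le> rw_form V c \<phi>"
    and "(\<Sum>\<pi> | \<pi> permutes V. f \<pi>) = 0"
  shows "2 * \<gamma> * (\<Sum>\<pi> | \<pi> permutes V. (f \<pi>)\<^sup>2) \<le> ip_form V c f"
  using assms
proof (induction "card V" arbitrary: V c f rule: less_induct)
  case less
  note fin = \<open>finite V\<close> and c_sym = less.prems(2) and c_nonneg = less.prems(3) and gap = less.prems(4)
  have nonneg: "ip_form V c f \<ge> 0" using c_nonneg by (rule ip_form_nonneg)
  consider "\<gamma> \<le> 0" | "card V \<le> 1" | "\<gamma> > 0" "card V \<ge> 2" by linarith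
  then show ?case
  proof cases
    case 1
    then have "2 * \<gamma> * (\<Sum>\<pi> | \<pi> permutes V. (f \<pi>)\<^sup>2) \<le> 0"
      by (intro mult_nonpos_nonneg[of "2 * \<gamma>"] sum_nonneg) auto
    with nonneg show ?thesis by linarith
  next
    case 2
    \<comment> \<open>The identity is the only permutation, so mean zero forces \<open>f\<close> to
      vanish there.\<close>
    then have "2 * \<gamma> * (\<Sum>\<pi> | \<pi> permutes V. (f \<pi>)\<^sup>2) = 0"
      using less.prems(5) perms_small[OF fin] by simp
    with nonneg show ?thesis by linarith
  next
    case 3
    let ?P = "{\<pi>. \<pi> permutes V}" and ?w = "\<lambda>(y, z). c y z"
    interpret ip: involution_walk ?P "V \<times> V" ?w "\<lambda>(y, z) \<pi>. transpose y z \<circ> \<pi>"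
      by (rule involution_walk_perms) (use fin in auto)
    interpret rw: involution_walk V "V \<times> V" ?w "\<lambda>(y, z). transpose y z"
      by (rule involution_walk_vertices) (use fin in auto)
    have ip_energy: "ip.energy g = ip_form V c g" for g
      unfolding ip.energy_def ip_form_def swap_energy_def sum.cartesian_product
      by (intro sum.cong refl) auto
    have rw_energy: "rw.energy \<phi> = 2 * rw_form V c \<phi>" for \<phi>
    proof -
      have "rw_form V c \<phi> = (\<Sum>(y, z)\<in>V \<times> V. c y z * (\<phi> y - \<phi> z)\<^sup>2)"
        by (simp add: rw_form_def sum.cartesian_product)
      then show ?thesis
        unfolding rw.energy_def
        by (simp only: sum_distrib_left[of 2], intro sum.cong refl)
          (auto simp: sum_transpose_diff_square[OF fin])
    qed
    have "card ?P \<ge> 2"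
      using 3 card_permutations[OF refl fin] fact_mono_nat[of 2 "card V"] by simp
    then obtain g \<mu> where g: "(\<Sum>\<pi>\<in>?P. g \<pi>) = 0" "(\<Sum>\<pi>\<in>?P. (g \<pi>)\<^sup>2) = 1" "ip.energy g = 2 * \<mu>"
      and bound: "\<And>h. (\<Sum>\<pi>\<in>?P. h \<pi>) = 0 \<Longrightarrow> 2 * \<mu> * (\<Sum>\<pi>\<in>?P. (h \<pi>)\<^sup>2) \<le> ip.energy h"
      and eig: "\<And>\<pi>. \<pi> \<in> ?P \<Longrightarrow> ip.gen g \<pi> = - \<mu> * g \<pi>"
      using ip.energy_minimizer by blast
    \<comment> \<open>A permutation maps particles to vertices; \<open>marg i\<close> is the
      projection of \<open>g\<close> to the position of particle \<open>i\<close>.\<close>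
    define marg where "marg i y = (\<Sum>\<pi>\<in>?P. g \<pi> * of_bool (\<pi> i = y))" for i y
    have "\<gamma> \<le> \<mu>"
    proof (cases "\<exists>i\<in>V. \<exists>y\<in>V. marg i y \<noteq> 0")
      case True
      text \<open>A non-zero marginal of the minimizer is an eigenfunction of the random walk.\<close>
      then obtain i y0 where i: "i \<in> V" and y0: "y0 \<in> V" "marg i y0 \<noteq> 0" by blast
      have mean: "(\<Sum>y\<in>V. marg i y) = 0"
      proof -
        have "(\<Sum>y\<in>V. marg i y) = (\<Sum>\<pi>\<in>?P. \<Sum>y\<in>V. g \<pi> * of_bool (\<pi> i = y))"
          unfolding marg_def by (rule sum.swap)
        also have "\<dots> = (\<Sum>\<pi>\<in>?P. g \<pi>)"
          using i by (intro sum.cong refl sum_of_bool_eq fin) (auto simp: permutes_in_image)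
        finally show ?thesis using g by simp
      qed
      have gen: "rw.gen (marg i) y = - \<mu> * marg i y" if y: "y \<in> V" for y
      proof -
        \<comment> \<open>Reindexing by the swap transfers it from the position to the
          configuration, so the projection intertwines the two generators.\<close>
        have step: "marg i (transpose u v y) - marg i y
            = (\<Sum>\<pi>\<in>?P. (g (transpose u v \<circ> \<pi>) - g \<pi>) * of_bool (\<pi> i = y))"
          if "u \<in> V" "v \<in> V" for u v
        proof -
          have "marg i (transpose u v y)
              = (\<Sum>\<pi>\<in>?P. g (transpose u v \<circ> \<pi>) * of_bool ((transpose u v \<circ> \<pi>) i = transpose u v y))"
            unfolding marg_def by (rule setum_permutations_compose_left[OF permutes_swap_id[OF that]])
          also have "\<dots> = (\<Sum>\<pi>\<in>?P. g (transpose u v \<circ> \<pi>) * of_bool (\<pi> i = y))"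
          proof -
            have "(transpose u v \<circ> \<pi>) i = transpose u v y \<longleftrightarrow> \<pi> i = y" for \<pi>
              by (metis comp_apply transpose_involutory)
            then show ?thesis by (simp only:)
          qed
          finally show ?thesis by (simp add: marg_def sum_subtractf left_diff_distrib)
        qed
        have "rw.gen (marg i) y = (\<Sum>e\<in>V \<times> V. \<Sum>\<pi>\<in>?P.
            ?w e * ((g ((case e of (u, v) \<Rightarrow> \<lambda>\<pi>. transpose u v \<circ> \<pi>) \<pi>) - g \<pi>) * of_bool (\<pi> i = y)))"
          unfolding rw.gen_def by (intro sum.cong refl) (auto simp: step sum_distrib_left)
        also have "\<dots> = (\<Sum>\<pi>\<in>?P. ip.gen g \<pi> * of_bool (\<pi> i = y))"
          by (subst sum.swap) (simp add: ip.gen_def sum_distrib_right mult.assoc)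
        also have "\<dots> = - \<mu> * marg i y"
          by (simp add: eig marg_def sum_distrib_left mult.assoc sum_negf)
        finally show ?thesis .
      qed
      have "rw.energy (marg i) = 2 * \<mu> * (\<Sum>y\<in>V. (marg i y)\<^sup>2)"
        by (simp add: rw.energy_gen gen sum_distrib_left sum_negf power2_eq_square ac_simps)
      then have "\<gamma> * (\<Sum>y\<in>V. (marg i y)\<^sup>2) \<le> \<mu> * (\<Sum>y\<in>V. (marg i y)\<^sup>2)"
        using gap[OF mean] by (simp add: rw_energy)
      moreover have "(\<Sum>y\<in>V. (marg i y)\<^sup>2) > 0"
        using y0 by (intro sum_pos2[OF fin]) auto
      ultimately show ?thesis by simp
    next
      case False
      obtain x where x: "x \<in> V" using 3 by fastforce
      let ?Y = "V - {x}" and ?r = "reduced V x c" and ?g = "\<lambda>i \<sigma>. g (\<sigma> \<circ> transpose x i)"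
      \<comment> \<open>The slice of \<open>i\<close> consists of the permutations sending
        \<open>i\<close> to \<open>x\<close>, so its sum is \<open>marg i x\<close>, which is zero
        in this case.\<close>
      have slice_mean: "(\<Sum>\<sigma> | \<sigma> permutes ?Y. ?g i \<sigma>) = 0" if i: "i \<in> V" for i
      proof -
        have "0 = marg i x" using False i x by auto
        also have "\<dots> = (\<Sum>i'\<in>V. \<Sum>\<sigma> | \<sigma> permutes ?Y. ?g i' \<sigma> * of_bool ((\<sigma> \<circ> transpose x i') i = x))"
          unfolding marg_def by (rule sum_permutations_remove[OF fin x])
        also have "\<dots> = (\<Sum>i'\<in>V. (\<Sum>\<sigma> | \<sigma> permutes ?Y. ?g i' \<sigma>) * of_bool (i = i'))"
        proof (intro sum.cong refl)
          fix i' assume "i' \<in> V"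
          have "(\<sigma> \<circ> transpose x i') i = x \<longleftrightarrow> i = i'" if "\<sigma> permutes ?Y" for \<sigma>
          proof -
            have "\<sigma> x = x" using that by (rule permutes_not_in) simp
            then have "\<sigma> v = x \<longleftrightarrow> v = x" for v
              using permutes_inj[OF that] by (metis injD)
            then show ?thesis by (auto simp: transpose_def)
          qed
          then show "(\<Sum>\<sigma> | \<sigma> permutes ?Y. ?g i' \<sigma> * of_bool ((\<sigma> \<circ> transpose x i') i = x))
              = (\<Sum>\<sigma> | \<sigma> permutes ?Y. ?g i' \<sigma>) * of_bool (i = i')"
            by (simp add: sum_distrib_right)
        qed
        also have "\<dots> = (\<Sum>\<sigma> | \<sigma> permutes ?Y. ?g i \<sigma>)"
          by (rule sum_of_bool_eq[OF fin i])
        finally show ?thesis by simp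
      qed
      have IH: "2 * \<gamma> * (\<Sum>\<sigma> | \<sigma> permutes ?Y. (?g i \<sigma>)\<^sup>2) \<le> ip_form ?Y ?r (?g i)" if i: "i \<in> V" for i
      proof (rule less.hyps)
        show "card ?Y < card V" using fin x by (rule card_Diff1_less)
        show "finite ?Y" using fin by simp
        show "?r y z = ?r z y" if "y \<in> ?Y" "z \<in> ?Y" for y z
          using that c_sym by (simp add: reduced_def mult.commute)
        show "0 \<le> ?r y z" if "y \<in> ?Y" "z \<in> ?Y" for y z
          using that c_nonneg x by (auto simp: reduced_def intro!: add_nonneg_nonneg divide_nonneg_nonneg sum_nonneg)
        show "\<gamma> * (\<Sum>v\<in>?Y. (\<phi> v)\<^sup>2) \<le> rw_form ?Y ?r \<phi>" if "(\<Sum>v\<in>?Y. \<phi> v) = 0" for \<phi>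
          using fin x c_sym c_nonneg _ gap that by (rule rw_gap_reduced) (use 3 in auto)
        show "(\<Sum>\<sigma> | \<sigma> permutes ?Y. ?g i \<sigma>) = 0" by (rule slice_mean[OF i])
      qed
      \<comment> \<open>The unit norm of \<open>g\<close> splits over the slices, and so do the swap
        energies; \<open>ip_form_reduced\<close> then returns to \<open>V\<close>.\<close>
      have "2 * \<gamma> = (\<Sum>i\<in>V. 2 * \<gamma> * (\<Sum>\<sigma> | \<sigma> permutes ?Y. (?g i \<sigma>)\<^sup>2))"
        using g(2) unfolding sum_permutations_remove[OF fin x] by (simp add: sum_distrib_left[symmetric])
      also have "\<dots> \<le> (\<Sum>i\<in>V. ip_form ?Y ?r (?g i))" by (intro sum_mono IH)
      also have "\<dots> = (\<Sum>y\<in>?Y. \<Sum>z\<in>?Y. ?r y z * swap_energy V g y z)"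
        unfolding ip_form_def swap_energy_remove[OF fin x] sum_distrib_left
        by (subst sum.swap) (intro sum.cong refl sum.swap)
      also have "\<dots> \<le> ip_form V c g"
        using fin x c_sym c_nonneg by (rule ip_form_reduced)
      also have "\<dots> = 2 * \<mu>" using g(3) by (simp add: ip_energy)
      finally show ?thesis by simp
    qed
    then have "2 * \<gamma> * (\<Sum>\<pi>\<in>?P. (f \<pi>)\<^sup>2) \<le> 2 * \<mu> * (\<Sum>\<pi>\<in>?P. (f \<pi>)\<^sup>2)"
      by (intro mult_right_mono sum_nonneg) auto
    also have "\<dots> \<le> ip_form V c f"
      using bound[OF less.prems(5)] by (simp add: ip_energy)
    finally show ?thesis .
  qed
qed

section \<open>Equality of the two gaps for connected graphs\<close>

lemma sum_permutations_eval:
  fixes h :: "'a \<Rightarrow> real"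
  assumes "finite V" "i \<in> V"
  shows "(\<Sum>\<pi> | \<pi> permutes V. h (\<pi> i)) = real (card {\<sigma>. \<sigma> permutes V - {i}}) * (\<Sum>v\<in>V. h v)"
proof -
  have V: "insert i (V - {i}) = V" using assms by auto
  \<comment> \<open>The value at \<open>i\<close> is equidistributed: the permutations sending
    \<open>i\<close> to a given \<open>v\<close> form a coset of those fixing
    \<open>i\<close>.\<close>
  have "(\<Sum>\<pi> | \<pi> permutes V. h (\<pi> i)) = (\<Sum>v\<in>V. \<Sum>\<sigma> | \<sigma> permutes V - {i}. h ((transpose i v \<circ> \<sigma>) i))"
    using sum_over_permutations_insert[of "V - {i}" i "\<lambda>\<pi>. h (\<pi> i)"] assms unfolding V by simp
  also have "\<dots> = (\<Sum>v\<in>V. \<Sum>\<sigma> | \<sigma> permutes V - {i}. h v)"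
  proof (intro sum.cong refl)
    fix v \<sigma> assume "\<sigma> \<in> {\<sigma>. \<sigma> permutes V - {i}}"
    then have "\<sigma> i = i" by (auto intro: permutes_not_in)
    then show "h ((transpose i v \<circ> \<sigma>) i) = h v" by simp
  qed
  finally show ?thesis by (simp add: sum_distrib_left)
qed

lemma sum_edge_pairs_symmetric:
  fixes h :: "nat \<Rightarrow> nat \<Rightarrow> real"
  assumes "P \<subseteq> X \<times> X" "finite X" "\<And>y z. (y, z) \<in> P \<Longrightarrow> y < z" "\<And>y z. h y z = h z y"
  shows "(\<Sum>y\<in>X. \<Sum>z\<in>X. of_bool ((y, z) \<in> P \<or> (z, y) \<in> P) * h y z) = 2 * (\<Sum>(y, z)\<in>P. h y z)"
proof -
  have fin: "finite P" using assms by (meson finite_SigmaI finite_subset)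
  have "(\<Sum>y\<in>X. \<Sum>z\<in>X. of_bool ((y, z) \<in> P \<or> (z, y) \<in> P) * h y z)
      = (\<Sum>(y, z)\<in>X \<times> X. of_bool ((y, z) \<in> P \<or> (z, y) \<in> P) * h y z)"
    by (simp add: sum.cartesian_product)
  also have "\<dots> = (\<Sum>(y, z)\<in>P \<union> P\<inverse>. h y z)"
    using assms(1,2) by (intro sum.mono_neutral_cong_right) auto
  also have "\<dots> = (\<Sum>(y, z)\<in>P. h y z) + (\<Sum>(y, z)\<in>P\<inverse>. h y z)"
    using assms(3) fin by (intro sum.union_disjoint) (auto, metis less_asym)
  also have "(\<Sum>(y, z)\<in>P\<inverse>. h y z) = (\<Sum>(y, z)\<in>P. h y z)"
    by (rule sum.reindex_bij_witness[of _ prod.swap prod.swap]) (auto simp: assms(4))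
  finally show ?thesis by simp
qed

text \<open>One inequality is \<open>interchange_gap\<close>; for the other, lifting a random walk
  minimizer to the position of a single particle multiplies squared norm and energy by the same
  factor \<open>K\<close>. Connectedness makes the gap nonzero: a function of zero energy is
  constant, which mean zero and norm one exclude.\<close>

theorem gaps_eq_of_connected:
  fixes V :: "'a set"
  assumes "finite V" "card V \<ge> 2" and enum: "enumerates x V"
    and connected: "\<And>\<psi> :: 'a \<Rightarrow> real. (\<And>a b. a \<in> V \<Longrightarrow> b \<in> V \<Longrightarrow> {a, b} \<in> E \<Longrightarrow> \<psi> a = \<psi> b)
      \<Longrightarrow> (\<exists>k. \<forall>a\<in>V. \<psi> a = k)"
  shows "IP_gap V E x = RW_gap V E x" "RW_gap V E x \<noteq> 0"
proof -
  define X where "X = {1..card V}"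
  define P where "P = edge_pairs V E x"
  let ?S = "{\<pi>. \<pi> permutes X}" and ?c = "\<lambda>y z. of_bool ((y, z) \<in> P \<or> (z, y) \<in> P) :: real"
  have X: "finite X" "card X \<ge> 2" using assms(2) by (auto simp: X_def)
  have PX: "P \<subseteq> X \<times> X" and P_less: "\<And>y z. (y, z) \<in> P \<Longrightarrow> y < z"
    by (auto simp: P_def X_def edge_pairs_def)
  have rw_walk: "involution_walk X P (\<lambda>(y, z). transpose y z)"
    by (rule involution_walk_vertices) (use X PX in auto)
  have ip_walk: "involution_walk ?S P (\<lambda>(y, z) \<pi>. transpose y z \<circ> \<pi>)"
    by (rule involution_walk_perms) (use X PX in auto)
  interpret rw: involution_walk X P "\<lambda>_. 1" "\<lambda>(y, z). transpose y z" by (rule rw_walk)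
  interpret ip: involution_walk ?S P "\<lambda>_. 1" "\<lambda>(y, z) \<pi>. transpose y z \<circ> \<pi>" by (rule ip_walk)
  have rw_energy: "rw.energy \<phi> = rw_form X ?c \<phi>" for \<phi>
  proof -
    have "rw.energy \<phi> = (\<Sum>(y, z)\<in>P. 2 * (\<phi> y - \<phi> z)\<^sup>2)"
      unfolding rw.energy_def using PX
      by (intro sum.cong refl) (auto simp: sum_transpose_diff_square[OF X(1)])
    also have "\<dots> = rw_form X ?c \<phi>"
      unfolding rw_form_def using sum_edge_pairs_symmetric[OF PX X(1) P_less, of "\<lambda>y z. (\<phi> y - \<phi> z)\<^sup>2"]
      by (simp add: power2_commute sum_distrib_left case_prod_unfold)
    finally show ?thesis .
  qed
  have ip_energy: "2 * ip.energy g = ip_form X ?c g" for g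
  proof -
    have "ip.energy g = (\<Sum>(y, z)\<in>P. swap_energy X g y z)"
      unfolding ip.energy_def swap_energy_def by (intro sum.cong refl) auto
    then show ?thesis
      using sum_edge_pairs_symmetric[OF PX X(1) P_less swap_energy_commute, of X g]
      unfolding ip_form_def by (simp only:)
  qed
  obtain f \<mu> where f: "(\<Sum>a\<in>X. f a) = 0" "(\<Sum>a\<in>X. (f a)\<^sup>2) = 1" "rw.energy f = 2 * \<mu>"
    and f_min: "\<And>h. (\<Sum>a\<in>X. h a) = 0 \<Longrightarrow> 2 * \<mu> * (\<Sum>a\<in>X. (h a)\<^sup>2) \<le> rw.energy h"
    using rw.energy_minimizer[OF X(2)] by metis
  have card_S: "card ?S \<ge> 2"
    using X card_permutations[OF refl X(1)] fact_mono_nat[of 2 "card X"] by simp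
  obtain g \<nu> where g: "(\<Sum>\<pi>\<in>?S. g \<pi>) = 0" "(\<Sum>\<pi>\<in>?S. (g \<pi>)\<^sup>2) = 1" "ip.energy g = 2 * \<nu>"
    and g_min: "\<And>h. (\<Sum>\<pi>\<in>?S. h \<pi>) = 0 \<Longrightarrow> 2 * \<nu> * (\<Sum>\<pi>\<in>?S. (h \<pi>)\<^sup>2) \<le> ip.energy h"
    using ip.energy_minimizer[OF card_S] by metis
  have RW: "RW_gap V E x = \<mu>"
    unfolding RW_gap_def X_def[symmetric]
    by (rule spectral_gap_eq[OF rw_walk _ f f_min])
      (unfold RW_gen_def P_def, intro sum.cong refl, auto)
  have IP: "IP_gap V E x = \<nu>"
    unfolding IP_gap_def X_def[symmetric]
    by (rule spectral_gap_eq[OF ip_walk _ g g_min])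
      (unfold IP_gen_def P_def, intro sum.cong refl, auto)
  have "\<mu> \<le> \<nu>"
  proof -
    \<comment> \<open>Here \<open>2 * \<mu>\<close> takes the place of \<open>\<gamma>\<close>,
      since \<open>rw.energy\<close> over \<open>P\<close> equals \<open>rw_form\<close>.\<close>
    have "2 * (2 * \<mu>) * (\<Sum>\<pi>\<in>?S. (g \<pi>)\<^sup>2) \<le> ip_form X ?c g"
      using f_min by (intro interchange_gap X(1) g(1)) (auto simp: rw_energy)
    then show ?thesis unfolding ip_energy[symmetric] g by simp
  qed
  moreover have "\<nu> \<le> \<mu>"
  proof -
    obtain i where i: "i \<in> X" using X(2) by fastforce
    define K where "K = real (card {\<sigma>. \<sigma> permutes X - {i}})"
    have "K > 0"
      using X(1) by (auto simp: K_def card_gt_0_iff finite_permutations intro!: exI[of _ id] permutes_id)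
    have eval: "(\<Sum>\<pi>\<in>?S. h (\<pi> i)) = K * (\<Sum>a\<in>X. h a)" for h :: "nat \<Rightarrow> real"
      unfolding K_def by (rule sum_permutations_eval[OF X(1) i])
    have swap: "(\<Sum>\<pi>\<in>?S. (f ((transpose y z \<circ> \<pi>) i) - f (\<pi> i))\<^sup>2)
        = K * (\<Sum>a\<in>X. (f (transpose y z a) - f a)\<^sup>2)" for y z
      using eval[of "\<lambda>a. (f (transpose y z a) - f a)\<^sup>2"] by simp
    have "ip.energy (\<lambda>\<pi>. f (\<pi> i)) = (\<Sum>(y, z)\<in>P. \<Sum>\<pi>\<in>?S. (f ((transpose y z \<circ> \<pi>) i) - f (\<pi> i))\<^sup>2)"
      unfolding ip.energy_def by (intro sum.cong refl) auto
    also have "\<dots> = K * rw.energy f"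
      unfolding rw.energy_def sum_distrib_left[of K] swap
      by (intro sum.cong refl) (auto simp: sum_distrib_left)
    finally have "ip.energy (\<lambda>\<pi>. f (\<pi> i)) = K * (2 * \<mu>)" by (simp only: f)
    moreover have "2 * \<nu> * (\<Sum>\<pi>\<in>?S. (f (\<pi> i))\<^sup>2) \<le> ip.energy (\<lambda>\<pi>. f (\<pi> i))"
      by (rule g_min) (simp add: eval f)
    ultimately show ?thesis
      using \<open>K > 0\<close> eval[of "\<lambda>a. (f a)\<^sup>2"] f(2) by simp
  qed
  ultimately show "IP_gap V E x = RW_gap V E x" by (simp add: RW IP)
  show "RW_gap V E x \<noteq> 0"
  proof
    assume "RW_gap V E x = 0"
    then have "(\<Sum>e\<in>P. \<Sum>a\<in>X. (f ((case e of (y, z) \<Rightarrow> transpose y z) a) - f a)\<^sup>2) = 0"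
      using f(3) by (simp add: RW rw.energy_def)
    then have "\<forall>e\<in>P. \<forall>a\<in>X. f ((case e of (y, z) \<Rightarrow> transpose y z) a) = f a"
      using X(1) PX by (simp add: sum_nonneg_eq_0_iff sum_nonneg finite_subset[OF PX])
    then have edge: "f z = f y" if "(y, z) \<in> P" for y z
      using that PX by force
    have bij: "bij_betw x X V" using enum by (simp add: enumerates_def X_def)
    have "\<exists>k. \<forall>a\<in>V. f (inv_into X x a) = k"
    proof (rule connected)
      fix a b assume "a \<in> V" "b \<in> V" "{a, b} \<in> E"
      moreover from this obtain i j where ij: "i \<in> X" "j \<in> X" "x i = a" "x j = b"
        using bij unfolding bij_betw_def by blast
      ultimately have "(i, j) \<in> P \<or> (j, i) \<in> P \<or> i = j"
        by (auto simp: P_def X_def edge_pairs_def insert_commute)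
      then have "f i = f j" using edge by auto
      then show "f (inv_into X x a) = f (inv_into X x b)"
        using ij bij by (auto simp: bij_betw_def)
    qed
    then obtain k where "f i = k" if "i \<in> X" for i
      using bij by (metis bij_betw_apply bij_betw_inv_into_left)
    then show False using f(1,2) X by auto
  qed
qed

section \<open>Connectedness of the grid\<close>

lemma grid_connected:
  fixes \<psi> :: "(nat \<Rightarrow> int) \<Rightarrow> real"
  assumes "\<And>a b. a \<in> grid d n \<Longrightarrow> b \<in> grid d n \<Longrightarrow> {a, b} \<in> grid_edges d n \<Longrightarrow> \<psi> a = \<psi> b"
  shows "\<exists>k. \<forall>a\<in>grid d n. \<psi> a = k"
proof -
  define base where "base = (\<lambda>k\<in>{1..d}. 1::int)"
  have "\<psi> p = \<psi> base" if "p \<in> grid d n" for p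
    using that
  \<comment> \<open>Induction on the distance from the corner \<open>base\<close>: lowering a
    coordinate that exceeds 1 moves along an edge inside the grid.\<close>
  proof (induction "\<Sum>k=1..d. nat (p k - 1)" arbitrary: p rule: less_induct)
    case less
    show ?case
    proof (cases "\<exists>k\<in>{1..d}. p k \<noteq> 1")
      case False
      then have "p = base" using less.prems by (auto simp: grid_def base_def PiE_iff extensional_def fun_eq_iff)
      then show ?thesis by simp
    next
      case True
      then obtain k where k: "k \<in> {1..d}" "p k \<noteq> 1" by blast
      then have pk: "p k > 1" using less.prems by (auto simp: grid_def PiE_iff order.order_iff_strict)
      define q where "q = p(k := p k - 1)"
      have q: "q \<in> grid d n" using less.prems k pk
        by (auto simp: grid_def PiE_iff extensional_def q_def intro: order_trans[of _ "p k"])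
      have "(\<Sum>j=1..d. nat (q j - 1)) < (\<Sum>j=1..d. nat (p j - 1))"
        using k(1) pk by (intro sum_strict_mono_ex1) (auto simp: q_def)
      then have "\<psi> q = \<psi> base" using q by (rule less.hyps)
      moreover have "(\<Sum>j=1..d. \<bar>p j - q j\<bar>) = 1"
      proof -
        have "(\<Sum>j=1..d. \<bar>p j - q j\<bar>) = (\<Sum>j=1..d. if j = k then 1 else 0)"
          by (intro sum.cong) (auto simp: q_def)
        then show ?thesis using k(1) by simp
      qed
      then have "{p, q} \<in> grid_edges d n" using less.prems q by (auto simp: grid_edges_def)
      then have "\<psi> p = \<psi> q" by (rule assms[OF less.prems q])
      ultimately show ?thesis by simp
    qed
  qed
  then show ?thesis by blast
qed

theorem theorem1p1:
  fixes d :: nat and x :: "nat \<Rightarrow> nat \<Rightarrow> (nat \<Rightarrow> int)"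
  assumes "d \<ge> 1"
    and "\<And>n. n \<ge> 2 \<Longrightarrow> enumerates (x n) (grid d n)"
  shows "(\<lambda>n. IP_gap (grid d n) (grid_edges d n) (x n) / RW_gap (grid d n) (grid_edges d n) (x n))
           \<longlonglongrightarrow> 1"
proof (rule tendsto_eventually)
  \<comment> \<open>The quotient is exactly 1 for every \<open>n \<ge> 2\<close>.\<close>
  show "\<forall>\<^sub>F n in sequentially.
      IP_gap (grid d n) (grid_edges d n) (x n) / RW_gap (grid d n) (grid_edges d n) (x n) = 1"
    using eventually_ge_at_top[of 2]
  proof eventually_elim
    case (elim n)
    have fin: "finite (grid d n)" by (simp add: grid_def finite_PiE)
    have "card (grid d n) = n ^ d" by (simp add: grid_def card_PiE)
    moreover have "n ^ 1 \<le> n ^ d" using assms(1) elim by (intro power_increasing) auto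
    ultimately have card: "card (grid d n) \<ge> 2" using elim by simp
    show ?case
      using gaps_eq_of_connected[OF fin card assms(2)[OF elim] grid_connected] by simp
  qed
qed

end
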